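(* Let $G=N\rtimes H$, $M$, $\mathcal U$, $D$ and $\alpha$ be as in the context. Suppose that $\mathcal U$ has finite quotients, i.e. $|U/V|<\infty$ whenever $U,V\in\mathcal U$ and $V\subseteq U$, and that $H$ acts effectively on $M$, i.e. for each $a\neq e$ in $H$ there exists $s\in M$ such that $asa^{-1}\neq s$. Then the reduced crossed product $D\rtimes_{\alpha,r}G$ is simple and purely infinite.
   Context: $G=N\rtimes H$ is a discrete group which is a semidirect product with normal subgroup $N$ and quotient group $H$ (regarded as a subgroup of $G$, acting on $N$ by conjugation), and $M\neq\{e\}$ is a normal subgroup of $N$. Put $\mathcal U=\{aMa^{-1}:a\in H\}$, a family of normal subgroups of $N$. Standing assumptions: (filter base) for all $U,V\in\mathcal U$ there is $W\in\mathcal U$ with $W\subseteq U\cap V$; (separating) $\bigcap_{U\in\mathcal U}U=\{e\}$. For $g=xa\in G$ with $x\in N$, $a\in H$, let $\beta_g:N\to N$ be the bijection $\beta_g(y)=xaya^{-1}$; $g\mapsto\beta_g$ is an action of $G$ on the set $N$. Let $\alpha$ be the action of $G$ on $\ell^\infty(N)$ given by $\alpha_g(f)=f\circ\beta_{g^{-1}}$. The set $\mathcal P=\{\chi_{xU}:x\in N,U\in\mathcal U\}\subseteq\ell^\infty(N)$ of characteristic functions of cosets is $\alpha$-invariant, and $D=C^*(\mathcal P)$ is the $C^*$-subalgebra of $\ell^\infty(N)$ generated by $\mathcal P$; $\alpha$ restricts to an action of $G$ on $D$, also denoted $\alpha$. *)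

theory Defs
  imports "HOL-Analysis.Analysis" "HOL-Algebra.Coset"
begin

section \<open>The Hilbert space of square-summable functions\<close>

typedef 'x ell2 = "{f :: 'x \<Rightarrow> complex. (\<lambda>i. (cmod (f i))\<^sup>2) summable_on UNIV}"
  by (rule exI[of _ "\<lambda>_. 0"]) simp

setup_lifting type_definition_ell2

lemma ell2_sq_summable: "(\<lambda>i. (cmod (Rep_ell2 x i))\<^sup>2) summable_on UNIV"
  using Rep_ell2[of x] by simp

lemma sq_summable_add:
  fixes f g :: "'x \<Rightarrow> complex"
  assumes "(\<lambda>i. (cmod (f i))\<^sup>2) summable_on UNIV" "(\<lambda>i. (cmod (g i))\<^sup>2) summable_on UNIV"
  shows "(\<lambda>i. (cmod (f i + g i))\<^sup>2) summable_on UNIV"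
proof (rule summable_on_comparison_test)
  show "(\<lambda>i. 2 * (cmod (f i))\<^sup>2 + 2 * (cmod (g i))\<^sup>2) summable_on UNIV"
    by (intro summable_on_add summable_on_cmult_right assms)
next
  fix i
  have "(cmod (f i + g i))\<^sup>2 \<le> (cmod (f i) + cmod (g i))\<^sup>2"
    by (intro power_mono norm_triangle_ineq) simp
  also have "\<dots> \<le> 2 * (cmod (f i))\<^sup>2 + 2 * (cmod (g i))\<^sup>2"
    using sum_squares_bound[of "cmod (f i)" "cmod (g i)"] by (simp add: power2_sum)
  finally show "(cmod (f i + g i))\<^sup>2 \<le> 2 * (cmod (f i))\<^sup>2 + 2 * (cmod (g i))\<^sup>2" .
qed simp

lemma sq_summable_mult:
  fixes f :: "'x \<Rightarrow> complex"
  assumes "(\<lambda>i. (cmod (f i))\<^sup>2) summable_on UNIV"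
  shows "(\<lambda>i. (cmod (c * f i))\<^sup>2) summable_on UNIV"
  using summable_on_cmult_right[OF assms, of "(cmod c)\<^sup>2"] by (simp add: norm_mult power_mult_distrib)

lemma ell2_mult_summable:
  fixes f g :: "'x \<Rightarrow> complex"
  assumes "(\<lambda>i. (cmod (f i))\<^sup>2) summable_on UNIV" "(\<lambda>i. (cmod (g i))\<^sup>2) summable_on UNIV"
  shows "(\<lambda>i. cnj (f i) * g i) summable_on UNIV"
proof -
  have "(\<lambda>i. norm (cnj (f i) * g i)) summable_on UNIV"
    by (rule abs_summable_product) (use assms in \<open>simp_all add: norm_mult power2_eq_square\<close>)
  then show ?thesis by (rule abs_summable_summable)
qed

instantiation ell2 :: (type) real_vector
begin
lift_definition zero_ell2 :: "'a ell2" is "\<lambda>_. 0" by simp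
lift_definition plus_ell2 :: "'a ell2 \<Rightarrow> 'a ell2 \<Rightarrow> 'a ell2" is "\<lambda>f g i. f i + g i"
  by (rule sq_summable_add)
lift_definition uminus_ell2 :: "'a ell2 \<Rightarrow> 'a ell2" is "\<lambda>f i. - f i" by simp
lift_definition minus_ell2 :: "'a ell2 \<Rightarrow> 'a ell2 \<Rightarrow> 'a ell2" is "\<lambda>f g i. f i - g i"
  subgoal for f g using sq_summable_add[of f "\<lambda>i. - g i"] by simp
  done
lift_definition scaleR_ell2 :: "real \<Rightarrow> 'a ell2 \<Rightarrow> 'a ell2" is "\<lambda>r f i. complex_of_real r * f i"
  by (rule sq_summable_mult)
instance
  by standard (transfer; simp add: fun_eq_iff algebra_simps)+
end

lift_definition scaleC_ell2 :: "complex \<Rightarrow> 'a ell2 \<Rightarrow> 'a ell2" is "\<lambda>c f i. c * f i"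
  by (rule sq_summable_mult)

definition cinner_ell2 :: "'a ell2 \<Rightarrow> 'a ell2 \<Rightarrow> complex" where
  "cinner_ell2 x y = (\<Sum>\<^sub>\<infinity>i. cnj (Rep_ell2 x i) * Rep_ell2 y i)"

lemma Rep_ell2_summable_mult: "(\<lambda>i. cnj (Rep_ell2 x i) * Rep_ell2 y i) summable_on UNIV"
  by (intro ell2_mult_summable ell2_sq_summable)

lemma cinner_ell2_add_left: "cinner_ell2 (x + y) z = cinner_ell2 x z + cinner_ell2 y z"
  unfolding cinner_ell2_def
  by (simp add: plus_ell2.rep_eq distrib_right infsum_add Rep_ell2_summable_mult)

lemma cinner_ell2_scaleC_left: "cinner_ell2 (scaleC_ell2 c x) y = cnj c * cinner_ell2 x y"
  unfolding cinner_ell2_def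
  by (simp add: scaleC_ell2.rep_eq mult.assoc infsum_cmult_right')

lemma cinner_ell2_commute: "cinner_ell2 x y = cnj (cinner_ell2 y x)"
  unfolding cinner_ell2_def by (simp flip: infsum_cnj add: mult.commute)

lemma cinner_ell2_self:
  "cinner_ell2 x x = complex_of_real (\<Sum>\<^sub>\<infinity>i. (cmod (Rep_ell2 x i))\<^sup>2)"
proof -
  have "cinner_ell2 x x = (\<Sum>\<^sub>\<infinity>i. complex_of_real ((cmod (Rep_ell2 x i))\<^sup>2))"
    unfolding cinner_ell2_def
    by (intro infsum_cong) (simp only: mult.commute[of "cnj _"] complex_norm_square)
  also have "\<dots> = complex_of_real (\<Sum>\<^sub>\<infinity>i. (cmod (Rep_ell2 x i))\<^sup>2)"
    by (intro infsumI has_sum_of_real has_sum_infsum ell2_sq_summable)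
  finally show ?thesis .
qed

lemma scaleR_scaleC_ell2: "r *\<^sub>R (x :: 'a ell2) = scaleC_ell2 (complex_of_real r) x"
  by transfer simp

instantiation ell2 :: (type) real_inner
begin
definition inner_ell2 :: "'a ell2 \<Rightarrow> 'a ell2 \<Rightarrow> real" where
  "inner_ell2 x y = Re (cinner_ell2 x y)"
definition norm_ell2 :: "'a ell2 \<Rightarrow> real" where
  "norm_ell2 x = sqrt (inner x x)"
definition dist_ell2 :: "'a ell2 \<Rightarrow> 'a ell2 \<Rightarrow> real" where
  "dist_ell2 x y = norm (x - y)"
definition sgn_ell2 :: "'a ell2 \<Rightarrow> 'a ell2" where
  "sgn_ell2 x = x /\<^sub>R norm x"
definition uniformity_ell2 :: "('a ell2 \<times> 'a ell2) filter" where
  "uniformity_ell2 = (INF e\<in>{0<..}. principal {(x, y). dist x y < e})"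
definition open_ell2 :: "'a ell2 set \<Rightarrow> bool" where
  "open_ell2 U \<longleftrightarrow> (\<forall>x\<in>U. eventually (\<lambda>(x', y). x' = x \<longrightarrow> y \<in> U) uniformity)"
instance
proof
  fix x y z :: "'a ell2" and r :: real
  show "inner x y = inner y x"
    unfolding inner_ell2_def by (subst cinner_ell2_commute) simp
  show "inner (x + y) z = inner x z + inner y z"
    by (simp add: inner_ell2_def cinner_ell2_add_left)
  show "inner (r *\<^sub>R x) y = r * inner x y"
    by (simp add: inner_ell2_def scaleR_scaleC_ell2 cinner_ell2_scaleC_left)
  show "0 \<le> inner x x"
    by (simp add: inner_ell2_def cinner_ell2_self infsum_nonneg)
  show "inner x x = 0 \<longleftrightarrow> x = 0"
  proof
    assume "inner x x = 0"
    then have "(\<Sum>\<^sub>\<infinity>i. (cmod (Rep_ell2 x i))\<^sup>2) = 0"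
      by (simp add: inner_ell2_def cinner_ell2_self)
    then have "(cmod (Rep_ell2 x i))\<^sup>2 = 0" for i
      using nonneg_infsum_le_0D[OF _ ell2_sq_summable, of x i] by simp
    then show "x = 0"
      by (intro Rep_ell2_inject[THEN iffD1]) (simp add: zero_ell2.rep_eq fun_eq_iff)
  qed (simp add: inner_ell2_def cinner_ell2_def zero_ell2.rep_eq)
qed (simp_all add: norm_ell2_def dist_ell2_def sgn_ell2_def uniformity_ell2_def open_ell2_def)
end

lemma norm_ell2_sq: "(norm (x :: 'a ell2))\<^sup>2 = (\<Sum>\<^sub>\<infinity>i. (cmod (Rep_ell2 x i))\<^sup>2)"
  by (simp add: power2_norm_eq_inner inner_ell2_def cinner_ell2_self)


section \<open>Operators on \<open>ell2\<close>\<close>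

text \<open>
  The type \<open>'x ell2 \<Rightarrow>\<^sub>L 'x ell2\<close> consists of the bounded real-linear operators with the
  operator norm. All operators considered below are complex-linear; for these the adjoint exists
  and is unique.
\<close>

definition adj :: "('x ell2 \<Rightarrow>\<^sub>L 'x ell2) \<Rightarrow> ('x ell2 \<Rightarrow>\<^sub>L 'x ell2)" where
  "adj T = (THE S. \<forall>x y. cinner_ell2 (T x) y = cinner_ell2 x (blinfun_apply S y))"

definition ell2_op ::
  "(('x \<Rightarrow> complex) \<Rightarrow> ('x \<Rightarrow> complex)) \<Rightarrow> ('x ell2 \<Rightarrow>\<^sub>L 'x ell2)" where
  "ell2_op F = Blinfun (\<lambda>\<xi>. Abs_ell2 (F (Rep_ell2 \<xi>)))"

definition cscale_op :: "complex \<Rightarrow> ('x ell2 \<Rightarrow>\<^sub>L 'x ell2)" where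
  "cscale_op c = ell2_op (\<lambda>\<xi> i. c * \<xi> i)"

text \<open>
  All uses of \<open>ell2_op\<close> below are weighted composition operators of the following kind, so that
  they really denote the bounded operator given by the formula.
\<close>

lemma ell2_op_weighted:
  fixes w :: "'x \<Rightarrow> complex" and \<sigma> :: "'x \<Rightarrow> 'x"
  assumes bnd: "\<And>i. cmod (w i) \<le> C"
    and inj: "inj_on \<sigma> {i. w i \<noteq> 0}"
  shows "Rep_ell2 (ell2_op (\<lambda>\<xi> i. w i * \<xi> (\<sigma> i)) x) = (\<lambda>i. w i * Rep_ell2 x (\<sigma> i))"
proof -
  let ?S = "{i. w i \<noteq> 0}"
  let ?f = "\<lambda>(x :: 'x ell2) i. w i * Rep_ell2 x (\<sigma> i)"
  have C0: "0 \<le> C"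
    using bnd norm_ge_zero order_trans by blast
  have S: "(\<lambda>i. (cmod (Rep_ell2 x (\<sigma> i)))\<^sup>2) summable_on ?S"
    and le: "(\<Sum>\<^sub>\<infinity>i\<in>?S. (cmod (Rep_ell2 x (\<sigma> i)))\<^sup>2) \<le> (norm x)\<^sup>2" for x
  proof -
    have sub: "(\<lambda>i. (cmod (Rep_ell2 x i))\<^sup>2) summable_on \<sigma> ` ?S"
      by (rule summable_on_subset_banach[OF ell2_sq_summable]) simp
    then show "(\<lambda>i. (cmod (Rep_ell2 x (\<sigma> i)))\<^sup>2) summable_on ?S"
      using summable_on_reindex[OF inj, of "\<lambda>i. (cmod (Rep_ell2 x i))\<^sup>2"] by (simp add: o_def)
    have "(\<Sum>\<^sub>\<infinity>i\<in>?S. (cmod (Rep_ell2 x (\<sigma> i)))\<^sup>2) = (\<Sum>\<^sub>\<infinity>i\<in>\<sigma> ` ?S. (cmod (Rep_ell2 x i))\<^sup>2)"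
      using infsum_reindex[OF inj, of "\<lambda>i. (cmod (Rep_ell2 x i))\<^sup>2"] by (simp add: o_def)
    also have "\<dots> \<le> (\<Sum>\<^sub>\<infinity>i. (cmod (Rep_ell2 x i))\<^sup>2)"
      by (rule infsum_mono_neutral[OF sub ell2_sq_summable]) auto
    finally show "(\<Sum>\<^sub>\<infinity>i\<in>?S. (cmod (Rep_ell2 x (\<sigma> i)))\<^sup>2) \<le> (norm x)\<^sup>2"
      by (simp add: norm_ell2_sq)
  qed
  have ptw: "(cmod (?f x i))\<^sup>2 \<le> C\<^sup>2 * (cmod (Rep_ell2 x (\<sigma> i)))\<^sup>2" for x i
    using bnd[of i] by (auto simp: norm_mult power_mult_distrib intro!: mult_right_mono power_mono)
  have fsum_S: "(\<lambda>i. (cmod (?f x i))\<^sup>2) summable_on ?S" for x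
    by (rule summable_on_comparison_test[OF summable_on_cmult_right[OF S, of "C\<^sup>2"]])
      (use ptw in auto)
  have fsum: "(\<lambda>i. (cmod (?f x i))\<^sup>2) summable_on UNIV" for x
    using summable_on_cong_neutral[of UNIV ?S "\<lambda>i. (cmod (?f x i))\<^sup>2" "\<lambda>i. (cmod (?f x i))\<^sup>2"]
      fsum_S[of x] by auto
  have rep: "Rep_ell2 (Abs_ell2 (?f x)) = ?f x" for x
    by (rule Abs_ell2_inverse) (use fsum in auto)
  have fle: "(\<Sum>\<^sub>\<infinity>i. (cmod (?f x i))\<^sup>2) \<le> C\<^sup>2 * (norm x)\<^sup>2" for x
  proof -
    have "(\<Sum>\<^sub>\<infinity>i. (cmod (?f x i))\<^sup>2) = (\<Sum>\<^sub>\<infinity>i\<in>?S. (cmod (?f x i))\<^sup>2)"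
      by (rule infsum_cong_neutral) auto
    also have "\<dots> \<le> (\<Sum>\<^sub>\<infinity>i\<in>?S. C\<^sup>2 * (cmod (Rep_ell2 x (\<sigma> i)))\<^sup>2)"
      by (rule infsum_mono[OF fsum_S summable_on_cmult_right[OF S] ptw])
    also have "\<dots> = C\<^sup>2 * (\<Sum>\<^sub>\<infinity>i\<in>?S. (cmod (Rep_ell2 x (\<sigma> i)))\<^sup>2)"
      by (rule infsum_cmult_right')
    also have "\<dots> \<le> C\<^sup>2 * (norm x)\<^sup>2"
      by (intro mult_left_mono le) simp
    finally show ?thesis .
  qed
  have "bounded_linear (\<lambda>x. Abs_ell2 (?f x))"
  proof (rule bounded_linear_intro[where K = C])
    fix x y :: "'x ell2" and r :: real
    show "Abs_ell2 (?f (x + y)) = Abs_ell2 (?f x) + Abs_ell2 (?f y)"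
      unfolding Rep_ell2_inject[symmetric] plus_ell2.rep_eq[of "Abs_ell2 (?f x)"] rep
      by (simp add: plus_ell2.rep_eq distrib_left)
    show "Abs_ell2 (?f (r *\<^sub>R x)) = r *\<^sub>R Abs_ell2 (?f x)"
      unfolding Rep_ell2_inject[symmetric] scaleR_ell2.rep_eq[of r "Abs_ell2 (?f x)"] rep
      by (simp add: scaleR_ell2.rep_eq mult.left_commute)
    have "(norm (Abs_ell2 (?f x)))\<^sup>2 \<le> (norm x * C)\<^sup>2"
      using fle[of x] by (simp add: norm_ell2_sq rep power_mult_distrib mult.commute)
    then show "norm (Abs_ell2 (?f x)) \<le> norm x * C"
      by (rule power2_le_imp_le) (simp add: C0)
  qed
  then show ?thesis
    unfolding ell2_op_def by (simp add: bounded_linear_Blinfun_apply rep)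
qed

lemma cscale_op_apply: "cscale_op c x = scaleC_ell2 c x"
  using ell2_op_weighted[of "\<lambda>_. c" "cmod c" id x]
  by (intro Rep_ell2_inject[THEN iffD1]) (simp add: cscale_op_def scaleC_ell2.rep_eq)


section \<open>C*-algebras of operators\<close>

definition clinear_op :: "('x ell2 \<Rightarrow>\<^sub>L 'x ell2) \<Rightarrow> bool" where
  "clinear_op T \<longleftrightarrow> (\<forall>c x. T (scaleC_ell2 c x) = scaleC_ell2 c (T x))"

definition cstar_algebra :: "('x ell2 \<Rightarrow>\<^sub>L 'x ell2) set \<Rightarrow> bool" where
  "cstar_algebra A \<longleftrightarrow>
     (\<forall>T\<in>A. clinear_op T) \<and> subspace A \<and> closed A \<and>
     (\<forall>c. \<forall>T\<in>A. cscale_op c o\<^sub>L T \<in> A) \<and>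
     (\<forall>S\<in>A. \<forall>T\<in>A. S o\<^sub>L T \<in> A) \<and>
     (\<forall>T\<in>A. adj T \<in> A)"

definition closed_ideal :: "('x ell2 \<Rightarrow>\<^sub>L 'x ell2) set \<Rightarrow> ('x ell2 \<Rightarrow>\<^sub>L 'x ell2) set \<Rightarrow> bool" where
  "closed_ideal A J \<longleftrightarrow>
     J \<subseteq> A \<and> subspace J \<and> closed J \<and>
     (\<forall>c. \<forall>T\<in>J. cscale_op c o\<^sub>L T \<in> J) \<and>
     (\<forall>S\<in>A. \<forall>T\<in>J. S o\<^sub>L T \<in> J \<and> T o\<^sub>L S \<in> J)"

definition cstar_simple :: "('x ell2 \<Rightarrow>\<^sub>L 'x ell2) set \<Rightarrow> bool" where
  "cstar_simple A \<longleftrightarrow>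
     cstar_algebra A \<and> A \<noteq> {0} \<and> (\<forall>J. closed_ideal A J \<longrightarrow> J = {0} \<or> J = A)"

definition pos_cone :: "('x ell2 \<Rightarrow>\<^sub>L 'x ell2) set \<Rightarrow> ('x ell2 \<Rightarrow>\<^sub>L 'x ell2) set" where
  "pos_cone A = {adj c o\<^sub>L c | c. c \<in> A}"

definition hereditary_subalgebra ::
  "('x ell2 \<Rightarrow>\<^sub>L 'x ell2) set \<Rightarrow> ('x ell2 \<Rightarrow>\<^sub>L 'x ell2) set \<Rightarrow> bool" where
  "hereditary_subalgebra A B \<longleftrightarrow>
     cstar_algebra B \<and> B \<subseteq> A \<and>
     (\<forall>a b. a \<in> pos_cone A \<and> b \<in> pos_cone B \<and> b - a \<in> pos_cone A \<longrightarrow> a \<in> B)"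

definition projection :: "('x ell2 \<Rightarrow>\<^sub>L 'x ell2) \<Rightarrow> bool" where
  "projection p \<longleftrightarrow> p o\<^sub>L p = p \<and> adj p = p"

text \<open>
  An infinite projection is one that is Murray--von Neumann equivalent in \<open>A\<close> to a proper
  subprojection of itself; \<open>q \<le> p\<close> is expressed by \<open>p o\<^sub>L q = q\<close>.
\<close>

definition infinite_projection ::
  "('x ell2 \<Rightarrow>\<^sub>L 'x ell2) set \<Rightarrow> ('x ell2 \<Rightarrow>\<^sub>L 'x ell2) \<Rightarrow> bool" where
  "infinite_projection A p \<longleftrightarrow>
     p \<in> A \<and> projection p \<and>
     (\<exists>q v. q \<in> A \<and> projection q \<and> p o\<^sub>L q = q \<and> q \<noteq> p \<and>
        v \<in> A \<and> adj v o\<^sub>L v = p \<and> v o\<^sub>L adj v = q)"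

text \<open>
  The notion of pure infiniteness used for simple C*-algebras (Cuntz, Laca--Spielberg).
\<close>

definition purely_infinite :: "('x ell2 \<Rightarrow>\<^sub>L 'x ell2) set \<Rightarrow> bool" where
  "purely_infinite A \<longleftrightarrow>
     cstar_algebra A \<and>
     (\<forall>B. hereditary_subalgebra A B \<and> B \<noteq> {0} \<longrightarrow> (\<exists>p\<in>B. infinite_projection A p))"


section \<open>Bounded functions on a set\<close>

text \<open>Functions on \<open>X\<close> are represented by their extension by zero.\<close>

definition linf :: "'x set \<Rightarrow> ('x \<Rightarrow> complex) set" where
  "linf X = {f. (\<forall>y. y \<notin> X \<longrightarrow> f y = 0) \<and> bounded (f ` X)}"

definition linf_cstar_subalgebra :: "'x set \<Rightarrow> ('x \<Rightarrow> complex) set \<Rightarrow> bool" where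
  "linf_cstar_subalgebra X B \<longleftrightarrow>
     B \<subseteq> linf X \<and> (\<lambda>_. 0) \<in> B \<and>
     (\<forall>f\<in>B. \<forall>g\<in>B. (\<lambda>y. f y + g y) \<in> B \<and> (\<lambda>y. f y * g y) \<in> B) \<and>
     (\<forall>c. \<forall>f\<in>B. (\<lambda>y. c * f y) \<in> B) \<and>
     (\<forall>f\<in>B. (\<lambda>y. cnj (f y)) \<in> B) \<and>
     (\<forall>F. \<forall>f\<in>linf X. (\<forall>n. F n \<in> B) \<and> uniform_limit X F f sequentially \<longrightarrow> f \<in> B)"

definition linf_cstar_generated :: "'x set \<Rightarrow> ('x \<Rightarrow> complex) set \<Rightarrow> ('x \<Rightarrow> complex) set" where
  "linf_cstar_generated X P = \<Inter> {B. linf_cstar_subalgebra X B \<and> P \<subseteq> B}"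


section \<open>Reduced crossed products\<close>

text \<open>
  Let \<open>\<alpha>\<close> be an action of a discrete group \<open>G\<close> on a C*-subalgebra \<open>D\<close> of the bounded functions
  on \<open>X\<close>. Represent \<open>D\<close> faithfully by multiplication operators on \<open>\<ell>\<^sup>2(X)\<close>. The induced regular
  representation acts on \<open>\<ell>\<^sup>2(G, \<ell>\<^sup>2(X)) = \<ell>\<^sup>2(G \<times> X)\<close> by
  \<open>(\<pi>(d) \<xi>)(h) = \<alpha>\<^bsub>h\<^sup>-\<^sup>1\<^esub>(d) \<xi>(h)\<close> and \<open>(\<lambda>\<^sub>g \<xi>)(h) = \<xi>(g\<^sup>-\<^sup>1 h)\<close>. Here \<open>\<ell>\<^sup>2(G \<times> X)\<close> is the subspace
  of functions supported on \<open>carrier G \<times> X\<close>, and operators are extended by zero to its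
  orthogonal complement.
\<close>

definition regular_rep ::
  "('g, 'r) monoid_scheme \<Rightarrow> 'x set \<Rightarrow> ('g \<Rightarrow> ('x \<Rightarrow> complex) \<Rightarrow> ('x \<Rightarrow> complex))
    \<Rightarrow> ('x \<Rightarrow> complex) \<Rightarrow> (('g \<times> 'x) ell2 \<Rightarrow>\<^sub>L ('g \<times> 'x) ell2)" where
  "regular_rep G X \<alpha> d = ell2_op (\<lambda>\<xi> (h, y).
     if h \<in> carrier G \<and> y \<in> X then \<alpha> (inv\<^bsub>G\<^esub> h) d y * \<xi> (h, y) else 0)"

definition translation ::
  "('g, 'r) monoid_scheme \<Rightarrow> 'x set \<Rightarrow> 'g \<Rightarrow> (('g \<times> 'x) ell2 \<Rightarrow>\<^sub>L ('g \<times> 'x) ell2)" where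
  "translation G X g = ell2_op (\<lambda>\<xi> (h, y).
     if h \<in> carrier G \<and> y \<in> X then \<xi> (inv\<^bsub>G\<^esub> g \<otimes>\<^bsub>G\<^esub> h, y) else 0)"

lemma regular_rep_apply:
  assumes "\<And>h y. h \<in> carrier G \<Longrightarrow> y \<in> X \<Longrightarrow> cmod (\<alpha> (inv\<^bsub>G\<^esub> h) d y) \<le> C" and "0 \<le> C"
  shows "Rep_ell2 (regular_rep G X \<alpha> d x) (h, y) =
    (if h \<in> carrier G \<and> y \<in> X then \<alpha> (inv\<^bsub>G\<^esub> h) d y * Rep_ell2 x (h, y) else 0)"
proof -
  let ?w = "\<lambda>(h, y). if h \<in> carrier G \<and> y \<in> X then \<alpha> (inv\<^bsub>G\<^esub> h) d y else 0"
  have "regular_rep G X \<alpha> d = ell2_op (\<lambda>\<xi> i. ?w i * \<xi> (id i))"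
    unfolding regular_rep_def by (intro arg_cong[of _ _ ell2_op]) (auto simp: fun_eq_iff)
  moreover have "Rep_ell2 (ell2_op (\<lambda>\<xi> i. ?w i * \<xi> (id i)) x) = (\<lambda>i. ?w i * Rep_ell2 x (id i))"
    by (rule ell2_op_weighted[of _ C]) (use assms in auto)
  ultimately show ?thesis by simp
qed

lemma translation_apply:
  assumes "group G" and "g \<in> carrier G"
  shows "Rep_ell2 (translation G X g x) (h, y) =
    (if h \<in> carrier G \<and> y \<in> X then Rep_ell2 x (inv\<^bsub>G\<^esub> g \<otimes>\<^bsub>G\<^esub> h, y) else 0)"
proof -
  interpret group G by fact
  let ?w = "\<lambda>(h, y). if h \<in> carrier G \<and> y \<in> X then 1 else 0 :: complex"
  let ?s = "\<lambda>(h, y). (inv\<^bsub>G\<^esub> g \<otimes>\<^bsub>G\<^esub> h, y)"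
  have "translation G X g = ell2_op (\<lambda>\<xi> i. ?w i * \<xi> (?s i))"
    unfolding translation_def by (intro arg_cong[of _ _ ell2_op]) (auto simp: fun_eq_iff)
  moreover have "Rep_ell2 (ell2_op (\<lambda>\<xi> i. ?w i * \<xi> (?s i)) x) = (\<lambda>i. ?w i * Rep_ell2 x (?s i))"
    by (rule ell2_op_weighted[of _ 1]) (use assms in \<open>auto simp: inj_on_def\<close>)
  ultimately show ?thesis by simp
qed

text \<open>
  The closed linear span of the operators \<open>\<pi>(d) \<lambda>\<^sub>g\<close>. Since \<open>D\<close> is closed under complex scalars,
  the real span is the complex span. The operators \<open>\<pi>(d)\<close> and \<open>\<lambda>\<^sub>g\<close> need not themselves belong
  to it, as \<open>D\<close> need not be unital.
\<close>

definition reduced_crossed_product ::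
  "('g, 'r) monoid_scheme \<Rightarrow> 'x set \<Rightarrow> ('x \<Rightarrow> complex) set
    \<Rightarrow> ('g \<Rightarrow> ('x \<Rightarrow> complex) \<Rightarrow> ('x \<Rightarrow> complex)) \<Rightarrow> (('g \<times> 'x) ell2 \<Rightarrow>\<^sub>L ('g \<times> 'x) ell2) set" where
  "reduced_crossed_product G X D \<alpha> =
     closure (span {regular_rep G X \<alpha> d o\<^sub>L translation G X g | d g. d \<in> D \<and> g \<in> carrier G})"


section \<open>The action associated with a semidirect product\<close>

definition semidirect :: "('g, 'r) monoid_scheme \<Rightarrow> 'g set \<Rightarrow> 'g set \<Rightarrow> bool" where
  "semidirect G N H \<longleftrightarrow>
     N \<lhd> G \<and> subgroup H G \<and> N \<inter> H = {\<one>\<^bsub>G\<^esub>} \<and> N <#>\<^bsub>G\<^esub> H = carrier G"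

definition conjugates :: "('g, 'r) monoid_scheme \<Rightarrow> 'g set \<Rightarrow> 'g set \<Rightarrow> 'g set set" where
  "conjugates G H M = {a <#\<^bsub>G\<^esub> M #>\<^bsub>G\<^esub> inv\<^bsub>G\<^esub> a | a. a \<in> H}"

definition beta ::
  "('g, 'r) monoid_scheme \<Rightarrow> 'g set \<Rightarrow> 'g set \<Rightarrow> 'g \<Rightarrow> 'g \<Rightarrow> 'g" where
  "beta G N H g y =
     (THE z. \<exists>x\<in>N. \<exists>a\<in>H. g = x \<otimes>\<^bsub>G\<^esub> a \<and> z = x \<otimes>\<^bsub>G\<^esub> a \<otimes>\<^bsub>G\<^esub> y \<otimes>\<^bsub>G\<^esub> inv\<^bsub>G\<^esub> a)"

definition alpha ::
  "('g, 'r) monoid_scheme \<Rightarrow> 'g set \<Rightarrow> 'g set \<Rightarrow> 'g \<Rightarrow> ('g \<Rightarrow> complex) \<Rightarrow> ('g \<Rightarrow> complex)" where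
  "alpha G N H g f = (\<lambda>y. if y \<in> N then f (beta G N H (inv\<^bsub>G\<^esub> g) y) else 0)"

definition coset_functions ::
  "('g, 'r) monoid_scheme \<Rightarrow> 'g set \<Rightarrow> 'g set set \<Rightarrow> ('g \<Rightarrow> complex) set" where
  "coset_functions G N \<U> = {indicator (x <#\<^bsub>G\<^esub> U) | x U. x \<in> N \<and> U \<in> \<U>}"

definition coset_algebra ::
  "('g, 'r) monoid_scheme \<Rightarrow> 'g set \<Rightarrow> 'g set set \<Rightarrow> ('g \<Rightarrow> complex) set" where
  "coset_algebra G N \<U> = linf_cstar_generated N (coset_functions G N \<U>)"

end

theory Submission
  imports Defs
begin

text \<open>
  Let \<open>C\<close> range over the cosets \<open>xU\<close> with \<open>U \<in> \<U>\<close>. These form a base of clopen sets for a topology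
  on \<open>N\<close> in which the functions in \<open>D\<close> are continuous, and \<open>G\<close> permutes them transitively: \<open>H\<close>
  permutes \<open>\<U>\<close> and \<open>N\<close> translates. The action is topologically free: if \<open>g = za\<close> fixed \<open>xU\<close>
  pointwise, then \<open>a\<close> would centralize \<open>U\<close>, so \<open>a = 1\<close> by effectiveness and \<open>g = 1\<close>
  (\<open>moves_point_in_coset\<close>); since \<open>\<Inter>\<U> = {1}\<close>, a moved point has a neighbourhood disjoint from its
  image (\<open>displaced_coset\<close>). Finally \<open>\<Inter>\<U> = {1} \<noteq> M\<close> yields a proper inclusion of cosets.
  These properties are collected in the locale \<open>clopen_family\<close>; everything about the crossed product
  is derived from them.

  Let \<open>p\<^sub>C\<close> be the projection given by the indicator of \<open>C\<close>. If \<open>g \<noteq> 1\<close> and \<open>C\<close> is disjoint from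
  \<open>gC\<close>, then \<open>p\<^sub>C \<pi>(d) \<lambda>\<^sub>g p\<^sub>C = 0\<close>, while \<open>p\<^sub>C \<pi>(d) p\<^sub>C\<close> is nearly \<open>d(x) p\<^sub>C\<close> when \<open>C\<close> is small
  and near \<open>x\<close>. Thus every element of the crossed product is almost scalar after compression to a
  suitable \<open>C\<close> near a prescribed point, the scalar being a diagonal matrix coefficient
  (\<open>compression_almost_scalar\<close>). For \<open>b \<noteq> 0\<close> some coefficient \<open>r = \<parallel>b \<delta>\<parallel>\<^sup>2\<close> of \<open>b*b\<close> is positive, so
  \<open>p\<^sub>C b*b p\<^sub>C\<close> is invertible in the corner of \<open>p\<^sub>C\<close>, and an inverse square root gives \<open>d\<close> with
  \<open>(bd)*(bd) = p\<^sub>C\<close> (\<open>basic_projection_below\<close>).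

  Simplicity follows: a nonzero ideal contains some \<open>p\<^sub>C\<close>, hence all of them by transitivity, hence
  everything. For pure infiniteness, \<open>p\<^sub>C\<close> is an infinite projection because some \<open>g\<close> maps \<open>C\<close> onto
  a proper subset. If \<open>b\<close> lies in a hereditary subalgebra, then so does the projection \<open>(bd)(bd)*\<close>
  (\<open>hereditary_compress\<close>), which is equivalent to \<open>p\<^sub>C\<close> and therefore infinite.

  Square roots and inverses are constructed as fixed points of contractions. This needs only the
  completeness of the Hilbert space.
\<close>

section \<open>Completeness of the Hilbert space\<close>

lemma ell2_eqI: "(\<And>i. Rep_ell2 x i = Rep_ell2 y i) \<Longrightarrow> x = y"
  by (simp add: Rep_ell2_inject[symmetric] fun_eq_iff)

lemma blinfun_ell2_eqI:
  fixes S T :: "'x ell2 \<Rightarrow>\<^sub>L 'x ell2"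
  shows "(\<And>x i. Rep_ell2 (S x) i = Rep_ell2 (T x) i) \<Longrightarrow> S = T"
  by (intro blinfun_eqI ell2_eqI)

lemma sum_norm_coordinates_le:
  assumes "finite F"
  shows "(\<Sum>i\<in>F. (cmod (Rep_ell2 x i))\<^sup>2) \<le> (norm x)\<^sup>2"
  unfolding norm_ell2_sq
  by (rule finite_sum_le_infsum[OF ell2_sq_summable assms]) auto

lemma norm_coordinate_le: "cmod (Rep_ell2 x i) \<le> norm x"
  using sum_norm_coordinates_le[of "{i}" x] by (simp add: power2_le_iff_abs_le)

lemma norm_ell2_le:
  assumes "\<And>F. finite F \<Longrightarrow> (\<Sum>i\<in>F. (cmod (Rep_ell2 x i))\<^sup>2) \<le> c\<^sup>2" "0 \<le> c"
  shows "norm x \<le> c"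
proof -
  have "(norm x)\<^sup>2 \<le> c\<^sup>2"
    unfolding norm_ell2_sq
    by (rule infsum_le_finite_sums[OF ell2_sq_summable]) (use assms in auto)
  then show ?thesis by (rule power2_le_imp_le) fact
qed

instance ell2 :: (type) banach
proof
  fix X :: "nat \<Rightarrow> 'a ell2"
  assume X: "Cauchy X"
  have "Cauchy (\<lambda>n. Rep_ell2 (X n) i)" for i
  proof (rule CauchyI)
    fix e :: real assume "0 < e"
    then obtain K where K: "\<And>m n. m \<ge> K \<Longrightarrow> n \<ge> K \<Longrightarrow> norm (X m - X n) < e"
      using CauchyD[OF X] by blast
    have "norm (Rep_ell2 (X m) i - Rep_ell2 (X n) i) < e" if "m \<ge> K" "n \<ge> K" for m n
      using norm_coordinate_le[of "X m - X n" i] K[OF that] by (simp add: minus_ell2.rep_eq)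
    then show "\<exists>M. \<forall>m\<ge>M. \<forall>n\<ge>M. norm (Rep_ell2 (X m) i - Rep_ell2 (X n) i) < e"
      by blast
  qed
  then have "\<exists>l. (\<lambda>n. Rep_ell2 (X n) i) \<longlonglongrightarrow> l" for i
    by (simp add: Cauchy_convergent_iff convergent_def)
  then obtain L where L: "\<And>i. (\<lambda>n. Rep_ell2 (X n) i) \<longlonglongrightarrow> L i"
    by metis
  \<comment> \<open>Finite partial sums of the squared distance pass to the coordinatewise limit.\<close>
  have tail: "\<exists>K. \<forall>n\<ge>K. \<forall>F. finite F \<longrightarrow> (\<Sum>i\<in>F. (cmod (Rep_ell2 (X n) i - L i))\<^sup>2) \<le> e\<^sup>2"
    if "0 < e" for e
  proof -
    obtain K where K: "\<And>m n. m \<ge> K \<Longrightarrow> n \<ge> K \<Longrightarrow> norm (X m - X n) < e"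
      using CauchyD[OF X \<open>0 < e\<close>] by blast
    have "(\<Sum>i\<in>F. (cmod (Rep_ell2 (X n) i - L i))\<^sup>2) \<le> e\<^sup>2" if "n \<ge> K" "finite F" for n F
    proof (rule LIMSEQ_le_const2)
      show "(\<lambda>m. \<Sum>i\<in>F. (cmod (Rep_ell2 (X n) i - Rep_ell2 (X m) i))\<^sup>2)
          \<longlonglongrightarrow> (\<Sum>i\<in>F. (cmod (Rep_ell2 (X n) i - L i))\<^sup>2)"
        by (intro tendsto_intros L)
      have "(\<Sum>i\<in>F. (cmod (Rep_ell2 (X n) i - Rep_ell2 (X m) i))\<^sup>2) \<le> e\<^sup>2" if "m \<ge> K" for m
      proof -
        have "(\<Sum>i\<in>F. (cmod (Rep_ell2 (X n) i - Rep_ell2 (X m) i))\<^sup>2) \<le> (norm (X n - X m))\<^sup>2"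
          using sum_norm_coordinates_le[OF \<open>finite F\<close>, of "X n - X m"]
          by (simp add: minus_ell2.rep_eq)
        also have "\<dots> \<le> e\<^sup>2"
          using K[OF \<open>n \<ge> K\<close> \<open>m \<ge> K\<close>] by (intro power_mono) auto
        finally show ?thesis .
      qed
      then show "\<exists>K. \<forall>m\<ge>K. (\<Sum>i\<in>F. (cmod (Rep_ell2 (X n) i - Rep_ell2 (X m) i))\<^sup>2) \<le> e\<^sup>2"
        by blast
    qed
    then show ?thesis by blast
  qed
  obtain K where K: "\<And>F. finite F \<Longrightarrow> (\<Sum>i\<in>F. (cmod (Rep_ell2 (X K) i - L i))\<^sup>2) \<le> 1"
    using tail[of 1] by auto
  have "(\<lambda>i. (cmod (Rep_ell2 (X K) i - L i))\<^sup>2) summable_on UNIV"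
    by (rule nonneg_bdd_above_summable_on) (use K in \<open>auto simp: bdd_above_def\<close>)
  from sq_summable_add[OF ell2_sq_summable[of "X K"], of "\<lambda>i. - (Rep_ell2 (X K) i - L i)"] this
  have "(\<lambda>i. (cmod (L i))\<^sup>2) summable_on UNIV"
    by (simp add: norm_minus_commute)
  then have rep: "Rep_ell2 (Abs_ell2 L) = L"
    by (intro Abs_ell2_inverse) simp
  have "X \<longlonglongrightarrow> Abs_ell2 L"
  proof (rule LIMSEQ_I)
    fix e :: real assume "0 < e"
    then obtain K where K:
      "\<And>n F. n \<ge> K \<Longrightarrow> finite F \<Longrightarrow> (\<Sum>i\<in>F. (cmod (Rep_ell2 (X n) i - L i))\<^sup>2) \<le> (e / 2)\<^sup>2"
      using tail[of "e / 2"] by auto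
    have "norm (X n - Abs_ell2 L) \<le> e / 2" if "n \<ge> K" for n
      by (rule norm_ell2_le) (use K[OF that] \<open>0 < e\<close> in \<open>auto simp: minus_ell2.rep_eq rep\<close>)
    with \<open>0 < e\<close> show "\<exists>K. \<forall>n\<ge>K. norm (X n - Abs_ell2 L) < e"
      by (intro exI[of _ K]) (metis field_sum_of_halves less_add_same_cancel1 half_gt_zero order.strict_trans1)
  qed
  then show "convergent X" by (auto simp: convergent_def)
qed

lift_definition delta :: "'x \<Rightarrow> 'x ell2" is "\<lambda>j i. if i = j then 1 else 0"
proof -
  fix j :: 'x
  show "(\<lambda>i. (cmod (if i = j then 1 else 0))\<^sup>2) summable_on UNIV"
    by (rule finite_nonzero_values_imp_summable_on) auto
qed

lemma cinner_delta: "cinner_ell2 (delta j) x = Rep_ell2 x j"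
proof -
  have "cinner_ell2 (delta j) x = (\<Sum>\<^sub>\<infinity>i\<in>{j}. Rep_ell2 x i)"
    unfolding cinner_ell2_def by (rule infsum_cong_neutral) (auto simp: delta.rep_eq)
  then show ?thesis by simp
qed

lemma norm_delta: "norm (delta j) = 1"
proof -
  have "cinner_ell2 (delta j) (delta j) = 1"
    by (simp add: cinner_delta delta.rep_eq)
  then show ?thesis by (simp add: norm_ell2_def inner_ell2_def)
qed

section \<open>Adjoints\<close>

definition adjoint_pair :: "('x ell2 \<Rightarrow>\<^sub>L 'x ell2) \<Rightarrow> ('x ell2 \<Rightarrow>\<^sub>L 'x ell2) \<Rightarrow> bool" where
  "adjoint_pair T S \<longleftrightarrow> (\<forall>x y. cinner_ell2 (T x) y = cinner_ell2 x (S y))"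

lemma cinner_ext: "(\<And>x. cinner_ell2 x y = cinner_ell2 x z) \<Longrightarrow> y = z"
  by (metis cinner_delta ell2_eqI)

lemma adj_eq: "adjoint_pair T S \<Longrightarrow> adj T = S"
  unfolding adj_def adjoint_pair_def
  by (rule the_equality) (auto intro!: blinfun_eqI cinner_ext)

lemma adjoint_pair_sym: "adjoint_pair T S \<Longrightarrow> adjoint_pair S T"
  unfolding adjoint_pair_def by (metis cinner_ell2_commute)

lemma adjoint_pair_comp:
  "adjoint_pair T S \<Longrightarrow> adjoint_pair T' S' \<Longrightarrow> adjoint_pair (T o\<^sub>L T') (S' o\<^sub>L S)"
  by (simp add: adjoint_pair_def)

lemma cinner_add_right: "cinner_ell2 x (y + z) = cinner_ell2 x y + cinner_ell2 x z"
  by (subst (1 2 3) cinner_ell2_commute) (simp add: cinner_ell2_add_left)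

lemma cinner_scaleR_left: "cinner_ell2 (r *\<^sub>R x) y = r * cinner_ell2 x y"
  by (simp add: scaleR_scaleC_ell2 cinner_ell2_scaleC_left)

lemma cinner_scaleR_right: "cinner_ell2 x (r *\<^sub>R y) = r * cinner_ell2 x y"
  by (subst (1 2) cinner_ell2_commute) (simp add: cinner_scaleR_left)

lemma adjoint_pair_add:
  "adjoint_pair T S \<Longrightarrow> adjoint_pair T' S' \<Longrightarrow> adjoint_pair (T + T') (S + S')"
  by (simp add: adjoint_pair_def blinfun.add_left cinner_ell2_add_left cinner_add_right)

lemma adjoint_pair_scaleR: "adjoint_pair T S \<Longrightarrow> adjoint_pair (r *\<^sub>R T) (r *\<^sub>R S)"
  by (simp add: adjoint_pair_def blinfun.scaleR_left cinner_scaleR_left cinner_scaleR_right)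

lemma adjoint_pair_diff:
  "adjoint_pair T S \<Longrightarrow> adjoint_pair T' S' \<Longrightarrow> adjoint_pair (T - T') (S - S')"
  using adjoint_pair_add[of T S "(-1) *\<^sub>R T'" "(-1) *\<^sub>R S'"] adjoint_pair_scaleR[of T' S' "-1"]
  by simp

lemma norm_scaleC: "norm (scaleC_ell2 c x) = cmod c * norm x"
proof -
  have "(norm (scaleC_ell2 c x))\<^sup>2 = (cmod c * norm x)\<^sup>2"
    by (simp add: norm_ell2_sq scaleC_ell2.rep_eq norm_mult power_mult_distrib infsum_cmult_right')
  then show ?thesis by simp
qed

lemma bounded_linear_scaleC: "bounded_linear (scaleC_ell2 c)"
proof (rule bounded_linear_intro[where K = "cmod c"])
  show "scaleC_ell2 c (x + y) = scaleC_ell2 c x + scaleC_ell2 c y" for x y :: "'a ell2"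
    by transfer (simp add: algebra_simps)
  show "scaleC_ell2 c (r *\<^sub>R x) = r *\<^sub>R scaleC_ell2 c x" for x :: "'a ell2" and r
    by transfer (simp add: algebra_simps)
qed (simp add: norm_scaleC mult.commute)

lemma cinner_eq_Complex: "cinner_ell2 x y = Complex (inner x y) (inner (scaleC_ell2 \<i> x) y)"
  by (simp add: complex_eq_iff inner_ell2_def cinner_ell2_scaleC_left)

lemma tendsto_cinner:
  assumes "(f \<longlongrightarrow> x) F" "(g \<longlongrightarrow> y) F"
  shows "((\<lambda>t. cinner_ell2 (f t) (g t)) \<longlongrightarrow> cinner_ell2 x y) F"
  unfolding cinner_eq_Complex
  by (intro tendsto_Complex tendsto_inner assms bounded_linear.tendsto[OF bounded_linear_scaleC])

lemma adjoint_pair_limit: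
  assumes "\<And>n. adjoint_pair (T n) (S n)" "T \<longlonglongrightarrow> T'" "S \<longlonglongrightarrow> S'"
  shows "adjoint_pair T' S'"
  unfolding adjoint_pair_def
proof (intro allI)
  fix x y
  have "(\<lambda>n. cinner_ell2 (T n x) y) \<longlonglongrightarrow> cinner_ell2 (T' x) y"
    by (intro tendsto_cinner tendsto_const blinfun.tendsto assms)
  moreover have "(\<lambda>n. cinner_ell2 x (S n y)) \<longlonglongrightarrow> cinner_ell2 x (S' y)"
    by (intro tendsto_cinner tendsto_const blinfun.tendsto assms)
  ultimately show "cinner_ell2 (T' x) y = cinner_ell2 x (S' y)"
    using assms(1) LIMSEQ_unique unfolding adjoint_pair_def by simp
qed

lemma closed_self_adjoint: "closed {T. adjoint_pair T T}"
  unfolding closed_sequential_limits by (auto intro: adjoint_pair_limit)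

lemma norm_adjoint_le:
  assumes "adjoint_pair T S"
  shows "norm S \<le> norm T"
proof (rule norm_blinfun_bound)
  fix y
  have "(norm (S y))\<^sup>2 = inner (T (S y)) y"
    using assms by (simp add: power2_norm_eq_inner inner_ell2_def adjoint_pair_def)
  also have "\<dots> \<le> norm (T (S y)) * norm y" by (rule norm_cauchy_schwarz)
  also have "\<dots> \<le> norm T * norm (S y) * norm y" by (intro mult_right_mono norm_blinfun) simp
  finally have "norm (S y) * norm (S y) \<le> norm (S y) * (norm T * norm y)"
    by (simp add: power2_eq_square mult_ac)
  then show "norm (S y) \<le> norm T * norm y"
    by (metis mult_left_le_imp_le mult_nonneg_nonneg norm_ge_zero order_le_less)
qed simp

text \<open>
  Since \<open>\<parallel>T*\<parallel> = \<parallel>T\<parallel>\<close>, adjoints survive norm limits. This is how operators in a closed span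
  obtain adjoints, without a representation theorem for bounded functionals.
\<close>

lemma closed_has_adjoint_in:
  assumes "closed A"
  shows "closed {T. \<exists>S\<in>A. adjoint_pair T S}"
  unfolding closed_sequential_limits
proof (intro allI impI, elim conjE)
  fix T T' assume "\<forall>n. T n \<in> {T. \<exists>S\<in>A. adjoint_pair T S}" and T': "T \<longlonglongrightarrow> T'"
  then obtain S where S: "\<And>n. S n \<in> A" "\<And>n. adjoint_pair (T n) (S n)"
    by (simp) metis
  have "Cauchy S"
  proof (rule metric_CauchyI)
    fix e :: real assume "0 < e"
    then obtain K where K: "\<And>m n. m \<ge> K \<Longrightarrow> n \<ge> K \<Longrightarrow> dist (T m) (T n) < e"
      using LIMSEQ_imp_Cauchy[OF T'] metric_CauchyD by blast
    have "dist (S m) (S n) < e" if "m \<ge> K" "n \<ge> K" for m n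
      using K[OF that] norm_adjoint_le[OF adjoint_pair_diff[OF S(2)[of m] S(2)[of n]]]
      by (simp add: dist_norm)
    then show "\<exists>M. \<forall>m\<ge>M. \<forall>n\<ge>M. dist (S m) (S n) < e" by blast
  qed
  then obtain S' where "S \<longlonglongrightarrow> S'"
    by (auto simp: Cauchy_convergent_iff convergent_def)
  with S T' show "T' \<in> {T. \<exists>S\<in>A. adjoint_pair T S}"
    using adjoint_pair_limit[of T S] closed_sequentially[OF assms] by blast
qed

lemma blinfun_compose_assoc: "(R o\<^sub>L S) o\<^sub>L T = R o\<^sub>L (S o\<^sub>L T)"
  by (auto intro!: blinfun_eqI)

lemmas compose_simps = blinfun_compose_assoc
  bounded_bilinear.diff_left[OF bounded_bilinear_blinfun_compose]
  bounded_bilinear.diff_right[OF bounded_bilinear_blinfun_compose]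
  bounded_bilinear.add_left[OF bounded_bilinear_blinfun_compose]
  bounded_bilinear.add_right[OF bounded_bilinear_blinfun_compose]
  bounded_bilinear.scaleR_left[OF bounded_bilinear_blinfun_compose]
  bounded_bilinear.scaleR_right[OF bounded_bilinear_blinfun_compose]

section \<open>Square roots and inverses by contraction\<close>

lemma continuous_on_blinfun_compose:
  "continuous_on K f \<Longrightarrow> continuous_on K g \<Longrightarrow> continuous_on K (\<lambda>t. f t o\<^sub>L g t)"
  by (rule bounded_bilinear.continuous_on[OF bounded_bilinear_blinfun_compose])

text \<open>
  For \<open>\<parallel>z\<parallel> < 1\<close> the square root of \<open>1 - z\<close> has the form \<open>1 - s\<close>, where \<open>s\<close> is a fixed point of
  \<open>s \<mapsto> (z + s\<^sup>2)/2\<close>. This map is a contraction on the ball of radius \<open>1 - \<surd>(1 - \<parallel>z\<parallel>)\<close>. Any closed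
  condition that the map preserves (self-adjointness, membership in an algebra or in a corner)
  is inherited by \<open>s\<close>, so no functional calculus is needed.
\<close>

lemma one_minus_square_root_exists:
  fixes z :: "'a::banach \<Rightarrow>\<^sub>L 'a"
  assumes z: "norm z < 1" and K: "closed K" "0 \<in> K"
    and step: "\<And>s. s \<in> K \<Longrightarrow> (1/2) *\<^sub>R (z + (s o\<^sub>L s)) \<in> K"
  obtains s where "s \<in> K" "norm s < 1" "s o\<^sub>L s = 2 *\<^sub>R s - z"
proof -
  define \<rho> where "\<rho> = 1 - sqrt (1 - norm z)"
  have \<rho>: "0 \<le> \<rho>" "\<rho> < 1" and \<rho>_eq: "norm z + \<rho> * \<rho> = 2 * \<rho>"
    using z by (auto simp: \<rho>_def algebra_simps)
  let ?f = "\<lambda>s. (1/2) *\<^sub>R (z + (s o\<^sub>L s))"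
  let ?S = "K \<inter> cball 0 \<rho>"
  have "\<exists>!s\<in>?S. ?f s = s"
  proof (rule Banach_fix[OF _ _ \<rho>])
    show "complete ?S" using K(1) by (simp add: complete_eq_closed closed_Int)
    show "?S \<noteq> {}" using K(2) \<rho>(1) by auto
    show "?f ` ?S \<subseteq> ?S"
    proof
      fix t assume "t \<in> ?f ` ?S"
      then obtain s where s: "s \<in> K" "norm s \<le> \<rho>" "t = ?f s" by auto
      have "norm (z + (s o\<^sub>L s)) \<le> norm z + norm s * norm s"
        by (intro order_trans[OF norm_triangle_ineq] add_left_mono norm_blinfun_compose)
      also have "\<dots> \<le> 2 * \<rho>"
        using s(2) \<rho>(1) by (subst \<rho>_eq[symmetric]) (intro add_left_mono mult_mono, auto)
      finally show "t \<in> ?S" using s step by simp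
    qed
    fix s t assume st: "s \<in> ?S" "t \<in> ?S"
    have eq: "(s o\<^sub>L s) - (t o\<^sub>L t) = (s o\<^sub>L (s - t)) + ((s - t) o\<^sub>L t)"
      by (simp add: compose_simps)
    have "norm ((s o\<^sub>L s) - (t o\<^sub>L t)) \<le> norm s * norm (s - t) + norm (s - t) * norm t"
      unfolding eq by (intro order_trans[OF norm_triangle_ineq] add_mono norm_blinfun_compose)
    also have "\<dots> \<le> \<rho> * norm (s - t) + norm (s - t) * \<rho>"
      using st \<rho>(1) by (intro add_mono mult_mono) auto
    finally have "norm ((s o\<^sub>L s) - (t o\<^sub>L t)) \<le> 2 * (\<rho> * norm (s - t))" by simp
    moreover have "?f s - ?f t = (1/2) *\<^sub>R ((s o\<^sub>L s) - (t o\<^sub>L t))"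
      by (simp add: scaleR_diff_right scaleR_add_right)
    ultimately show "dist (?f s) (?f t) \<le> \<rho> * dist s t"
      by (simp add: dist_norm)
  qed
  then obtain s where s: "s \<in> K" "norm s \<le> \<rho>" "?f s = s" by auto
  have "2 *\<^sub>R ?f s = 2 *\<^sub>R s" using s(3) by simp
  then have "s o\<^sub>L s = 2 *\<^sub>R s - z" by (simp add: algebra_simps)
  with s \<rho> show ?thesis by (intro that) auto
qed

lemma neumann_fixed_point_exists:
  fixes s p :: "'a::banach \<Rightarrow>\<^sub>L 'a"
  assumes s: "norm s < 1" and K: "closed K" "p \<in> K"
    and step: "\<And>y. y \<in> K \<Longrightarrow> p + (s o\<^sub>L y) \<in> K"
  obtains y where "y \<in> K" "y = p + (s o\<^sub>L y)"
proof -
  have "\<exists>!y\<in>K. p + (s o\<^sub>L y) = y"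
  proof (rule Banach_fix[OF _ _ norm_ge_zero s])
    show "complete K" using K(1) by (simp add: complete_eq_closed)
    fix y t
    have "(p + (s o\<^sub>L y)) - (p + (s o\<^sub>L t)) = s o\<^sub>L (y - t)" by (simp add: compose_simps)
    then show "dist (p + (s o\<^sub>L y)) (p + (s o\<^sub>L t)) \<le> norm s * dist y t"
      by (metis dist_norm norm_blinfun_compose)
  qed (use K step in auto)
  then show ?thesis using that by metis
qed

section \<open>Algebras of operators that contain their adjoints\<close>

locale operator_star_algebra =
  fixes A :: "('x ell2 \<Rightarrow>\<^sub>L 'x ell2) set"
  assumes closed: "closed A" and subspace: "subspace A"
    and compose: "\<And>S T. S \<in> A \<Longrightarrow> T \<in> A \<Longrightarrow> S o\<^sub>L T \<in> A"
    and has_adjoint: "\<And>T. T \<in> A \<Longrightarrow> \<exists>S\<in>A. adjoint_pair T S"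
begin

lemmas closure_rules = compose subspace_add[OF subspace] subspace_diff[OF subspace]
  subspace_scale[OF subspace] subspace_0[OF subspace]

lemma adjoint_pair_adj: "T \<in> A \<Longrightarrow> adjoint_pair T (adj T)"
  using has_adjoint adj_eq by metis

lemma adj_in: "T \<in> A \<Longrightarrow> adj T \<in> A"
  using has_adjoint adj_eq by metis

lemma adj_adj: "T \<in> A \<Longrightarrow> adj (adj T) = T"
  using adjoint_pair_adj adjoint_pair_sym adj_eq by metis

lemma adj_compose: "S \<in> A \<Longrightarrow> T \<in> A \<Longrightarrow> adj (S o\<^sub>L T) = adj T o\<^sub>L adj S"
  using adjoint_pair_adj adjoint_pair_comp adj_eq by metis

lemma adj_diff: "S \<in> A \<Longrightarrow> T \<in> A \<Longrightarrow> adj (S - T) = adj S - adj T"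
  using adjoint_pair_adj adjoint_pair_diff adj_eq by metis

lemma adj_scaleR: "T \<in> A \<Longrightarrow> adj (r *\<^sub>R T) = r *\<^sub>R adj T"
  using adjoint_pair_adj adjoint_pair_scaleR adj_eq by metis

lemma adj_compose_self_eq_0:
  assumes "T \<in> A" "adj T o\<^sub>L T = 0"
  shows "T = 0"
proof (rule blinfun_eqI)
  fix x
  have "inner (T x) (T x) = inner x ((adj T o\<^sub>L T) x)"
    using adjoint_pair_adj[OF assms(1)] by (simp add: adjoint_pair_def inner_ell2_def)
  with assms(2) show "T x = blinfun_apply 0 x" by simp
qed

lemma partial_isometry_absorbs_source:
  assumes "w \<in> A" "adj w o\<^sub>L w = p" "projection p"
  shows "w o\<^sub>L p = w"
proof -
  have p: "p \<in> A" "p o\<^sub>L p = p" "adj p = p"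
    using assms by (auto simp: projection_def intro: compose adj_in)
  have "adj (w - (w o\<^sub>L p)) o\<^sub>L (w - (w o\<^sub>L p))
      = (adj w o\<^sub>L w) - ((adj w o\<^sub>L w) o\<^sub>L p) - (p o\<^sub>L (adj w o\<^sub>L w)) + (p o\<^sub>L ((adj w o\<^sub>L w) o\<^sub>L p))"
    using assms(1) p(1,3) by (simp add: adj_diff adj_compose compose compose_simps)
  also have "\<dots> = 0" by (simp add: assms(2) p)
  finally have "w - (w o\<^sub>L p) = 0"
    by (rule adj_compose_self_eq_0[rotated]) (intro closure_rules assms(1) p(1))
  then show ?thesis by simp
qed

text \<open>
  If \<open>pb*bp\<close> is close to a positive multiple \<open>rp\<close>, it is invertible in the corner \<open>pAp\<close>, and
  \<open>y = (pb*bp/r)\<^sup>-\<^sup>1\<^sup>/\<^sup>2\<close> turns \<open>bp\<close> into a partial isometry with source projection \<open>p\<close>. Here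
  \<open>(p - s)\<^sup>2 = pb*bp/r\<close> and \<open>y\<close> is the inverse of \<open>p - s\<close> in the corner.
\<close>

lemma corner_partial_isometry:
  assumes b: "b \<in> A" and p: "p \<in> A" "projection p" and r: "0 < r"
    and near: "norm (p - (1/r) *\<^sub>R (p o\<^sub>L adj b o\<^sub>L b o\<^sub>L p)) < 1"
  obtains d where "d \<in> A" "adj (b o\<^sub>L d) o\<^sub>L (b o\<^sub>L d) = p"
proof -
  have pp: "p o\<^sub>L p = p" and pa: "adj p = p" using p(2) by (auto simp: projection_def)
  then have pp': "p o\<^sub>L (p o\<^sub>L T) = p o\<^sub>L T" for T :: "'x ell2 \<Rightarrow>\<^sub>L 'x ell2"
    by (metis blinfun_compose_assoc)
  define z where "z = p - (1/r) *\<^sub>R (p o\<^sub>L adj b o\<^sub>L b o\<^sub>L p)"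
  have za: "adj z = z"
    using b p(1) by (simp add: z_def adj_diff adj_scaleR adj_compose compose adj_in adj_adj pa
        subspace_scale[OF subspace] blinfun_compose_assoc)
  have zA: "z \<in> A"
    unfolding z_def by (intro closure_rules adj_in b p)
  define C where "C = {T \<in> A. adjoint_pair T T \<and> p o\<^sub>L T = T \<and> T o\<^sub>L p = T}"
  have C_iff: "T \<in> C \<longleftrightarrow> T \<in> A \<and> adj T = T \<and> p o\<^sub>L T = T \<and> T o\<^sub>L p = T" for T
    unfolding C_def mem_Collect_eq by (metis adjoint_pair_adj adj_eq)
  have C_eq: "C = A \<inter> {T. adjoint_pair T T} \<inter> {T. p o\<^sub>L T = T} \<inter> {T. T o\<^sub>L p = T}"
    by (auto simp: C_def)
  have closedC: "closed C"
    unfolding C_eq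
    by (intro closed_Int closed closed_self_adjoint closed_Collect_eq continuous_on_blinfun_compose
        continuous_on_const continuous_on_id)
  have zC: "z \<in> C"
    unfolding C_iff using zA za by (simp add: z_def compose_simps pp pp')
  obtain s where s: "s \<in> C" "norm s < 1" "s o\<^sub>L s = 2 *\<^sub>R s - z"
  proof (rule one_minus_square_root_exists[of z C])
    show "norm z < 1" using near by (simp add: z_def)
    show "0 \<in> C" by (auto simp: C_def adjoint_pair_def subspace_0[OF subspace] cinner_ell2_def zero_ell2.rep_eq)
    fix s assume "s \<in> C"
    then show "(1/2) *\<^sub>R (z + (s o\<^sub>L s)) \<in> C"
      using zC by (auto simp: C_def compose_simps
          intro!: closure_rules adjoint_pair_scaleR adjoint_pair_add adjoint_pair_comp)
         (metis blinfun_compose_assoc)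
  qed (use closedC in auto)
  have sA: "s \<in> A" "adj s = s" "p o\<^sub>L s = s" "s o\<^sub>L p = s" using s(1) by (auto simp: C_iff)
  define Y where "Y = C \<inter> {T. s o\<^sub>L T = T o\<^sub>L s}"
  obtain y where y: "y \<in> Y" "y = p + (s o\<^sub>L y)"
  proof (rule neumann_fixed_point_exists[OF s(2), of Y p])
    show "closed Y"
      unfolding Y_def
      by (intro closed_Int closedC closed_Collect_eq continuous_on_blinfun_compose
          continuous_on_const continuous_on_id)
    show "p \<in> Y" using p(1) pp pa sA by (simp add: Y_def C_iff)
    fix y assume y: "y \<in> Y"
    then have comm: "s o\<^sub>L y = y o\<^sub>L s" and yC: "y \<in> A" "adj y = y" "p o\<^sub>L y = y" "y o\<^sub>L p = y"
      by (auto simp: Y_def C_iff)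
    have "adjoint_pair (s o\<^sub>L y) (y o\<^sub>L s)"
      using adjoint_pair_comp[of s s y y] adjoint_pair_adj[of s] adjoint_pair_adj[of y] sA yC by simp
    then have "adjoint_pair (p + (s o\<^sub>L y)) (p + (s o\<^sub>L y))"
      using adjoint_pair_adj[OF p(1)] pa comm by (simp add: adjoint_pair_add)
    moreover have "p + (s o\<^sub>L y) \<in> A" by (intro closure_rules p sA yC)
    ultimately show "p + (s o\<^sub>L y) \<in> Y"
      using comm sA yC pp unfolding Y_def C_def
      by (simp add: compose_simps) (metis blinfun_compose_assoc)
  qed
  have yA: "y \<in> A" "adj y = y" "p o\<^sub>L y = y" "y o\<^sub>L p = y" "s o\<^sub>L y = y o\<^sub>L s"
    using y(1) by (auto simp: Y_def C_iff)
  have inv: "(p - s) o\<^sub>L y = p" "y o\<^sub>L (p - s) = p"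
    using y(2) yA by (simp_all add: compose_simps) (metis add_diff_cancel_right')+
  have sq: "(p - s) o\<^sub>L (p - s) = (1/r) *\<^sub>R (p o\<^sub>L adj b o\<^sub>L b o\<^sub>L p)"
  proof -
    have "(p - s) o\<^sub>L (p - s) = p - z"
      using s(3) sA pp by (simp add: compose_simps scaleR_2)
    then show ?thesis by (simp add: z_def)
  qed
  define d where "d = (1 / sqrt r) *\<^sub>R (p o\<^sub>L y)"
  have dA: "d \<in> A" unfolding d_def by (intro closure_rules p yA)
  have "adj (b o\<^sub>L d) o\<^sub>L (b o\<^sub>L d) = adj d o\<^sub>L adj b o\<^sub>L b o\<^sub>L d"
    using b dA by (simp add: adj_compose compose_simps)
  also have "adj d = (1 / sqrt r) *\<^sub>R (y o\<^sub>L p)"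
    unfolding d_def using p(1) yA pa by (simp add: adj_scaleR adj_compose compose)
  also have "((1 / sqrt r) *\<^sub>R (y o\<^sub>L p)) o\<^sub>L adj b o\<^sub>L b o\<^sub>L d
      = y o\<^sub>L ((1/r) *\<^sub>R (p o\<^sub>L adj b o\<^sub>L b o\<^sub>L p)) o\<^sub>L y"
    using r by (simp add: d_def compose_simps)
  also have "\<dots> = (y o\<^sub>L (p - s)) o\<^sub>L ((p - s) o\<^sub>L y)"
    by (subst sq[symmetric]) (simp only: blinfun_compose_assoc)
  also have "\<dots> = p" by (simp add: inv pp)
  finally show ?thesis using that dA by blast
qed

text \<open>
  A hereditary subalgebra \<open>B\<close> absorbs \<open>bdd*b*\<close> for \<open>b \<in> B\<close>, \<open>d \<in> A\<close>: for large \<open>c\<close> the element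
  \<open>c bb* - bdd*b*\<close> equals \<open>c b(1 - s)\<^sup>2b*\<close>, where \<open>1 - s\<close> is the square root of \<open>1 - dd*/c\<close>,
  and so it is positive.
\<close>

lemma hereditary_compress:
  assumes B: "hereditary_subalgebra A B" and b: "b \<in> B" and d: "d \<in> A"
  shows "(b o\<^sub>L d) o\<^sub>L adj (b o\<^sub>L d) \<in> B"
proof -
  have B_alg: "subspace B" "\<And>T. T \<in> B \<Longrightarrow> adj T \<in> B" "B \<subseteq> A"
    using B by (auto simp: hereditary_subalgebra_def cstar_algebra_def)
  then have bA: "b \<in> A" using b by auto
  define t where "t = d o\<^sub>L adj d"
  define c where "c = norm t + 1"
  have c: "0 < c" by (simp add: c_def add_nonneg_pos)
  have tA: "t \<in> A" unfolding t_def by (intro closure_rules adj_in d)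
  have t_self: "adjoint_pair t t"
    unfolding t_def using adjoint_pair_adj[OF d] adjoint_pair_sym adjoint_pair_comp by blast
  obtain s where s: "s \<in> A \<inter> {T. adjoint_pair T T}" "s o\<^sub>L s = 2 *\<^sub>R s - (1/c) *\<^sub>R t"
  proof (rule one_minus_square_root_exists[of "(1/c) *\<^sub>R t" "A \<inter> {T. adjoint_pair T T}"])
    show "norm ((1/c) *\<^sub>R t) < 1" using c by (simp add: c_def)
    show "closed (A \<inter> {T. adjoint_pair T T})" by (intro closed_Int closed closed_self_adjoint)
    show "0 \<in> A \<inter> {T. adjoint_pair T T}"
      by (auto simp: adjoint_pair_def subspace_0[OF subspace] cinner_ell2_def zero_ell2.rep_eq)
    show "(1/2) *\<^sub>R ((1/c) *\<^sub>R t + (s o\<^sub>L s)) \<in> A \<inter> {T. adjoint_pair T T}"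
      if "s \<in> A \<inter> {T. adjoint_pair T T}" for s
      using that tA t_self
      by (auto intro!: closure_rules adjoint_pair_scaleR adjoint_pair_add adjoint_pair_comp)
  qed auto
  have sA: "s \<in> A" "adj s = s" using s(1) adj_eq by auto
  define f where "f = sqrt c *\<^sub>R (adj b - (s o\<^sub>L adj b))"
  define w where "w = b o\<^sub>L d"
  have fA: "f \<in> A" unfolding f_def by (intro closure_rules adj_in bA sA)
  have wA: "w \<in> A" unfolding w_def by (intro closure_rules bA d)
  have fa: "adj f = sqrt c *\<^sub>R (b - (b o\<^sub>L s))"
    unfolding f_def using bA sA by (simp add: adj_scaleR adj_diff adj_compose compose adj_in adj_adj
        subspace_diff[OF subspace])
  have ss: "s o\<^sub>L (s o\<^sub>L T) = 2 *\<^sub>R (s o\<^sub>L T) - (1/c) *\<^sub>R (t o\<^sub>L T)" for T :: "'x ell2 \<Rightarrow>\<^sub>L 'x ell2"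
    unfolding blinfun_compose_assoc[symmetric] s(2) by (simp add: compose_simps)
  have "adj f o\<^sub>L f = c *\<^sub>R (b o\<^sub>L adj b) - (b o\<^sub>L (t o\<^sub>L adj b))"
    unfolding fa using c by (simp add: f_def compose_simps ss scaleR_diff_right scaleR_add_right scaleR_2)
  also have "b o\<^sub>L (t o\<^sub>L adj b) = w o\<^sub>L adj w"
    using bA d by (simp add: w_def t_def adj_compose compose_simps)
  finally have diff: "c *\<^sub>R (b o\<^sub>L adj b) - (w o\<^sub>L adj w) = adj f o\<^sub>L f" ..
  have "sqrt c *\<^sub>R adj b \<in> B" using B_alg b by (intro subspace_scale) auto
  moreover have "adj (sqrt c *\<^sub>R adj b) o\<^sub>L (sqrt c *\<^sub>R adj b) = c *\<^sub>R (b o\<^sub>L adj b)"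
    using bA c by (simp add: adj_scaleR adj_in adj_adj compose_simps)
  ultimately have "c *\<^sub>R (b o\<^sub>L adj b) \<in> pos_cone B"
    unfolding pos_cone_def by (metis (mono_tags, lifting) mem_Collect_eq)
  moreover have "w o\<^sub>L adj w \<in> pos_cone A"
    unfolding pos_cone_def using adj_in[OF wA] adj_adj[OF wA] by (metis (mono_tags, lifting) mem_Collect_eq)
  moreover have "c *\<^sub>R (b o\<^sub>L adj b) - (w o\<^sub>L adj w) \<in> pos_cone A"
    unfolding diff pos_cone_def using fA by blast
  ultimately have "w o\<^sub>L adj w \<in> B"
    using B unfolding hereditary_subalgebra_def by blast
  then show ?thesis by (simp add: w_def)
qed

text \<open>Conjugation by \<open>w\<close> carries a proper subprojection of \<open>w*w\<close> to one of \<open>ww*\<close>.\<close>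

lemma infinite_projection_transfer:
  assumes inf: "infinite_projection A p" and w: "w \<in> A" "adj w o\<^sub>L w = p"
  shows "infinite_projection A (w o\<^sub>L adj w)"
proof -
  from inf obtain q v where p: "p \<in> A" "projection p" and q: "q \<in> A" "projection q"
    and pq: "p o\<^sub>L q = q" "q \<noteq> p" and v: "v \<in> A" "adj v o\<^sub>L v = p" "v o\<^sub>L adj v = q"
    by (auto simp: infinite_projection_def)
  have pa: "p o\<^sub>L p = p" "adj p = p" and qa: "q o\<^sub>L q = q" "adj q = q"
    using p(2) q(2) by (auto simp: projection_def)
  have qp: "q o\<^sub>L p = q"
    using adj_compose[OF p(1) q(1)] pq(1) pa qa by simp
  have wp: "w o\<^sub>L p = w" by (rule partial_isometry_absorbs_source[OF w p(2)])
  have vp: "v o\<^sub>L p = v" by (rule partial_isometry_absorbs_source[OF v(1,2) p(2)])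
  have "q o\<^sub>L v = v" using vp v by (metis blinfun_compose_assoc)
  then have pv: "p o\<^sub>L v = v" using pq(1) by (metis blinfun_compose_assoc)
  have pw: "p o\<^sub>L adj w = adj w"
    using adj_compose[OF w(1) p(1)] wp pa by simp
  have w': "adj w o\<^sub>L (w o\<^sub>L T) = p o\<^sub>L T" and q': "q o\<^sub>L (q o\<^sub>L T) = q o\<^sub>L T"
    and p': "p o\<^sub>L (q o\<^sub>L T) = q o\<^sub>L T" "q o\<^sub>L (p o\<^sub>L T) = q o\<^sub>L T"
    and v': "adj v o\<^sub>L (v o\<^sub>L T) = p o\<^sub>L T" "v o\<^sub>L (adj v o\<^sub>L T) = q o\<^sub>L T"
    and pv': "p o\<^sub>L (v o\<^sub>L T) = v o\<^sub>L T"
    for T :: "'x ell2 \<Rightarrow>\<^sub>L 'x ell2"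
    using w(2) qa pq(1) qp v pv by (metis blinfun_compose_assoc)+
  have vpa: "p o\<^sub>L (adj v o\<^sub>L T) = adj v o\<^sub>L T" for T :: "'x ell2 \<Rightarrow>\<^sub>L 'x ell2"
    using adj_compose[OF v(1) p(1)] vp pa by (metis blinfun_compose_assoc)
  define V where "V = w o\<^sub>L (v o\<^sub>L adj w)"
  define Q where "Q = w o\<^sub>L (q o\<^sub>L adj w)"
  have VA: "V \<in> A" and QA: "Q \<in> A"
    unfolding V_def Q_def by (intro closure_rules adj_in w v q)+
  have Va: "adj V = w o\<^sub>L (adj v o\<^sub>L adj w)"
    unfolding V_def using w v by (simp add: adj_compose adj_in adj_adj compose blinfun_compose_assoc)
  have Qa: "adj Q = Q"
    unfolding Q_def using w q qa by (simp add: adj_compose adj_in adj_adj compose blinfun_compose_assoc)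
  have "Q \<noteq> w o\<^sub>L adj w"
  proof
    assume "Q = w o\<^sub>L adj w"
    then have "adj w o\<^sub>L (Q o\<^sub>L w) = adj w o\<^sub>L ((w o\<^sub>L adj w) o\<^sub>L w)" by simp
    then have "q = p"
      by (simp add: Q_def blinfun_compose_assoc w' w(2) qp pa p' pq(1))
    then show False using pq by simp
  qed
  moreover have "adj V o\<^sub>L V = w o\<^sub>L adj w" "V o\<^sub>L adj V = Q"
    unfolding Va by (simp_all add: V_def Q_def blinfun_compose_assoc w' pv' vpa v' pw)
  moreover have "projection Q" "projection (w o\<^sub>L adj w)" "(w o\<^sub>L adj w) o\<^sub>L Q = Q" "w o\<^sub>L adj w \<in> A"
    using Qa w by (auto simp: projection_def Q_def blinfun_compose_assoc w' p' q' pw adj_compose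
        adj_in adj_adj compose)
  ultimately show ?thesis
    using VA QA unfolding infinite_projection_def
    by - (intro conjI; (rule exI[of _ Q], rule exI[of _ V], intro conjI)?; assumption)
qed

end

section \<open>Bounded functions and group actions\<close>

lemma linf_bound:
  assumes "f \<in> linf X"
  obtains C where "0 \<le> C" "\<And>y. y \<in> X \<Longrightarrow> cmod (f y) \<le> C"
  using assms unfolding linf_def bounded_iff
  by simp (metis norm_ge_zero order_trans linear)

lemma linfI:
  assumes "\<And>y. y \<notin> X \<Longrightarrow> f y = 0" "\<And>y. y \<in> X \<Longrightarrow> cmod (f y) \<le> C"
  shows "f \<in> linf X"
  using assms unfolding linf_def bounded_iff by auto

lemma linf_outside: "f \<in> linf X \<Longrightarrow> y \<notin> X \<Longrightarrow> f y = 0"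
  by (simp add: linf_def)

lemma linf_zero: "(\<lambda>_. 0) \<in> linf X"
  by (rule linfI[of _ _ 0]) auto

lemma linf_add: "f \<in> linf X \<Longrightarrow> g \<in> linf X \<Longrightarrow> (\<lambda>y. f y + g y) \<in> linf X"
proof -
  assume f: "f \<in> linf X" and g: "g \<in> linf X"
  obtain C where "\<And>y. y \<in> X \<Longrightarrow> cmod (f y) \<le> C" using linf_bound[OF f] by blast
  moreover obtain C' where "\<And>y. y \<in> X \<Longrightarrow> cmod (g y) \<le> C'" using linf_bound[OF g] by blast
  ultimately show ?thesis
    by (intro linfI[of _ _ "C + C'"])
      (auto simp: linf_outside[OF f] linf_outside[OF g] intro: norm_triangle_mono)
qed

lemma linf_mult: "f \<in> linf X \<Longrightarrow> g \<in> linf X \<Longrightarrow> (\<lambda>y. f y * g y) \<in> linf X"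
proof -
  assume f: "f \<in> linf X" and g: "g \<in> linf X"
  obtain C where "0 \<le> C" "\<And>y. y \<in> X \<Longrightarrow> cmod (f y) \<le> C" using linf_bound[OF f] by blast
  moreover obtain C' where "\<And>y. y \<in> X \<Longrightarrow> cmod (g y) \<le> C'" using linf_bound[OF g] by blast
  ultimately show ?thesis
    by (intro linfI[of _ _ "C * C'"]) (auto simp: linf_outside[OF f] norm_mult intro!: mult_mono)
qed

lemma linf_cmult: "f \<in> linf X \<Longrightarrow> (\<lambda>y. c * f y) \<in> linf X"
proof -
  assume f: "f \<in> linf X"
  obtain C where "\<And>y. y \<in> X \<Longrightarrow> cmod (f y) \<le> C" using linf_bound[OF f] by blast
  then show ?thesis
    by (intro linfI[of _ _ "cmod c * C"]) (auto simp: linf_outside[OF f] norm_mult intro!: mult_left_mono)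
qed

lemma linf_cnj: "f \<in> linf X \<Longrightarrow> (\<lambda>y. cnj (f y)) \<in> linf X"
proof -
  assume f: "f \<in> linf X"
  obtain C where "\<And>y. y \<in> X \<Longrightarrow> cmod (f y) \<le> C" using linf_bound[OF f] by blast
  then show ?thesis
    by (intro linfI[of _ _ C]) (auto simp: linf_outside[OF f])
qed

lemma linf_diff: "f \<in> linf X \<Longrightarrow> g \<in> linf X \<Longrightarrow> (\<lambda>y. f y - g y) \<in> linf X"
  using linf_add[of f X "\<lambda>y. (-1) * g y"] linf_cmult[of g X "-1"] by simp

lemma linf_indicator: "C \<subseteq> X \<Longrightarrow> indicator C \<in> linf X"
  by (rule linfI[of _ _ 1]) (auto simp: indicator_def)

lemma linf_cstar_subalgebra_linf: "linf_cstar_subalgebra X (linf X)"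
  unfolding linf_cstar_subalgebra_def
  by (auto intro: linf_zero linf_add linf_mult linf_cmult linf_cnj)

lemma linf_cstar_subalgebra_generated:
  assumes "P \<subseteq> linf X"
  shows "linf_cstar_subalgebra X (linf_cstar_generated X P)"
  unfolding linf_cstar_subalgebra_def
proof (intro conjI)
  show "linf_cstar_generated X P \<subseteq> linf X"
    unfolding linf_cstar_generated_def using assms linf_cstar_subalgebra_linf by blast
  show "\<forall>F. \<forall>f\<in>linf X. (\<forall>n. F n \<in> linf_cstar_generated X P) \<and> uniform_limit X F f sequentially
      \<longrightarrow> f \<in> linf_cstar_generated X P"
    unfolding linf_cstar_generated_def linf_cstar_subalgebra_def Inter_iff by (intro allI ballI impI) blast
qed (simp_all add: linf_cstar_generated_def linf_cstar_subalgebra_def)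

lemma linf_cstar_generated_least:
  "linf_cstar_subalgebra X B \<Longrightarrow> P \<subseteq> B \<Longrightarrow> linf_cstar_generated X P \<subseteq> B"
  unfolding linf_cstar_generated_def by blast

lemma linf_cstar_generated_superset: "P \<subseteq> linf_cstar_generated X P"
  unfolding linf_cstar_generated_def by blast

locale discrete_action = group G for G :: "('g, 'r) monoid_scheme" (structure) +
  fixes X :: "'x set" and \<beta> :: "'g \<Rightarrow> 'x \<Rightarrow> 'x"
  assumes maps: "\<And>g y. g \<in> carrier G \<Longrightarrow> y \<in> X \<Longrightarrow> \<beta> g y \<in> X"
    and one: "\<And>y. y \<in> X \<Longrightarrow> \<beta> \<one> y = y"
    and mult: "\<And>g h y. g \<in> carrier G \<Longrightarrow> h \<in> carrier G \<Longrightarrow> y \<in> X \<Longrightarrow> \<beta> (g \<otimes> h) y = \<beta> g (\<beta> h y)"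
begin

definition act :: "'g \<Rightarrow> ('x \<Rightarrow> complex) \<Rightarrow> ('x \<Rightarrow> complex)" where
  "act g f = (\<lambda>y. if y \<in> X then f (\<beta> (inv g) y) else 0)"

lemma inverse_left: "g \<in> carrier G \<Longrightarrow> y \<in> X \<Longrightarrow> \<beta> (inv g) (\<beta> g y) = y"
  using mult[of "inv g" g y] by (simp add: one)

lemma inverse_right: "g \<in> carrier G \<Longrightarrow> y \<in> X \<Longrightarrow> \<beta> g (\<beta> (inv g) y) = y"
  using mult[of g "inv g" y] by (simp add: one)

lemma act_one: "f \<in> linf X \<Longrightarrow> act \<one> f = f"
  by (auto simp: act_def one fun_eq_iff linf_outside)

lemma act_indicator:
  assumes "g \<in> carrier G" "C \<subseteq> X"
  shows "act g (indicator C) = indicator (\<beta> g ` C)"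
proof
  fix y
  have "\<beta> (inv g) y \<in> C \<longleftrightarrow> y \<in> \<beta> g ` C" if "y \<in> X"
    using that assms inverse_right[of g y] inverse_left[of g] by (force intro: image_eqI[of _ _ "\<beta> (inv g) y"])
  moreover have "\<beta> g ` C \<subseteq> X" using assms maps by auto
  ultimately show "act g (indicator C) y = indicator (\<beta> g ` C) y"
    by (auto simp: act_def indicator_def)
qed

lemma linf_act:
  assumes "f \<in> linf X" "g \<in> carrier G"
  shows "act g f \<in> linf X"
proof -
  obtain C where "0 \<le> C" "\<And>y. y \<in> X \<Longrightarrow> cmod (f y) \<le> C" using linf_bound[OF assms(1)] by blast
  then show ?thesis
    using assms(2) by (intro linfI[of _ _ C]) (auto simp: act_def maps)
qed

section \<open>The regular representation\<close>

text \<open>The generators \<open>\<pi>(f) \<lambda>\<^sub>g\<close> of the crossed product, for arbitrary bounded \<open>f\<close>.\<close>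

definition W :: "('x \<Rightarrow> complex) \<Rightarrow> 'g \<Rightarrow> (('g \<times> 'x) ell2 \<Rightarrow>\<^sub>L ('g \<times> 'x) ell2)" where
  "W f g = regular_rep G X act f o\<^sub>L translation G X g"

lemma W_apply:
  assumes f: "f \<in> linf X" and g: "g \<in> carrier G"
  shows "Rep_ell2 (W f g \<xi>) (h, y) =
    (if h \<in> carrier G \<and> y \<in> X then f (\<beta> h y) * Rep_ell2 \<xi> (inv g \<otimes> h, y) else 0)"
proof -
  obtain C where C: "0 \<le> C" "\<And>y. y \<in> X \<Longrightarrow> cmod (f y) \<le> C" using linf_bound[OF f] by blast
  have "cmod (act (inv h) f y) \<le> C" if "h \<in> carrier G" "y \<in> X" for h y
    using that C maps by (simp add: act_def)
  from regular_rep_apply[of G X act f C, OF this C(1)] show ?thesis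
    by (simp add: W_def translation_apply[OF is_group g] act_def)
qed

lemma norm_W_le:
  assumes f: "f \<in> linf X" and g: "g \<in> carrier G" and C: "0 \<le> C" "\<And>y. y \<in> X \<Longrightarrow> cmod (f y) \<le> C"
  shows "norm (W f g) \<le> C"
proof (rule norm_blinfun_bound[OF C(1)], rule norm_ell2_le)
  fix \<xi> :: "('g \<times> 'x) ell2" and F :: "('g \<times> 'x) set"
  assume F: "finite F"
  let ?F = "F \<inter> carrier G \<times> X" and ?\<sigma> = "\<lambda>(h, y). (inv g \<otimes> h, y)"
  have "(\<Sum>i\<in>F. (cmod (Rep_ell2 (W f g \<xi>) i))\<^sup>2)
      = (\<Sum>(h, y)\<in>?F. (cmod (f (\<beta> h y)))\<^sup>2 * (cmod (Rep_ell2 \<xi> (inv g \<otimes> h, y)))\<^sup>2)"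
    by (rule sum.mono_neutral_cong_right[OF F])
      (auto simp: W_apply[OF f g] norm_mult power_mult_distrib split: if_splits)
  also have "\<dots> \<le> (\<Sum>(h, y)\<in>?F. C\<^sup>2 * (cmod (Rep_ell2 \<xi> (inv g \<otimes> h, y)))\<^sup>2)"
    by (rule sum_mono) (auto intro!: mult_right_mono power_mono C maps)
  also have "\<dots> = C\<^sup>2 * (\<Sum>i\<in>?F. (cmod (Rep_ell2 \<xi> (?\<sigma> i)))\<^sup>2)"
    by (simp add: sum_distrib_left case_prod_beta)
  also have "(\<Sum>i\<in>?F. (cmod (Rep_ell2 \<xi> (?\<sigma> i)))\<^sup>2) = (\<Sum>i\<in>?\<sigma> ` ?F. (cmod (Rep_ell2 \<xi> i))\<^sup>2)"
    by (subst sum.reindex) (use g in \<open>auto simp: inj_on_def\<close>)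
  also have "C\<^sup>2 * \<dots> \<le> C\<^sup>2 * (norm \<xi>)\<^sup>2"
    by (intro mult_left_mono sum_norm_coordinates_le) (use F in auto)
  finally show "(\<Sum>i\<in>F. (cmod (Rep_ell2 (W f g \<xi>) i))\<^sup>2) \<le> (C * norm \<xi>)\<^sup>2"
    by (simp add: power_mult_distrib)
qed (use C in auto)

lemma W_add: "f \<in> linf X \<Longrightarrow> f' \<in> linf X \<Longrightarrow> g \<in> carrier G \<Longrightarrow> W (\<lambda>y. f y + f' y) g = W f g + W f' g"
  by (rule blinfun_ell2_eqI)
    (auto simp: W_apply linf_add blinfun.add_left plus_ell2.rep_eq distrib_right)

lemma W_scaleC: "f \<in> linf X \<Longrightarrow> g \<in> carrier G \<Longrightarrow> W (\<lambda>y. c * f y) g = cscale_op c o\<^sub>L W f g"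
  by (rule blinfun_ell2_eqI)
    (auto simp: W_apply linf_cmult cscale_op_apply scaleC_ell2.rep_eq)

lemma W_scaleR: "f \<in> linf X \<Longrightarrow> g \<in> carrier G \<Longrightarrow> W (\<lambda>y. complex_of_real r * f y) g = r *\<^sub>R W f g"
  by (rule blinfun_ell2_eqI)
    (auto simp: W_apply linf_cmult blinfun.scaleR_left scaleR_ell2.rep_eq)

lemma W_diff: "f \<in> linf X \<Longrightarrow> f' \<in> linf X \<Longrightarrow> g \<in> carrier G \<Longrightarrow> W (\<lambda>y. f y - f' y) g = W f g - W f' g"
  by (rule blinfun_ell2_eqI)
    (auto simp: W_apply linf_diff blinfun.diff_left minus_ell2.rep_eq left_diff_distrib)

lemma W_zero: "g \<in> carrier G \<Longrightarrow> W (\<lambda>_. 0) g = 0"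
  using W_scaleR[OF linf_zero, of g 0] by simp

text \<open>The covariance relation \<open>\<lambda>\<^sub>g \<pi>(f) = \<pi>(\<alpha>\<^sub>g(f)) \<lambda>\<^sub>g\<close> in multiplied form.\<close>

lemma W_mult:
  assumes "f \<in> linf X" "f' \<in> linf X" "g \<in> carrier G" "g' \<in> carrier G"
  shows "W f g o\<^sub>L W f' g' = W (\<lambda>y. f y * act g f' y) (g \<otimes> g')"
proof (rule blinfun_ell2_eqI)
  fix \<xi> and i :: "'g \<times> 'x"
  obtain h y where i: "i = (h, y)" by fastforce
  have "\<beta> (inv g) (\<beta> h y) = \<beta> (inv g \<otimes> h) y" if "h \<in> carrier G" "y \<in> X"
    using that assms by (simp add: mult)
  moreover have "inv (g \<otimes> g') \<otimes> h = inv g' \<otimes> (inv g \<otimes> h)" if "h \<in> carrier G"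
    using that assms by (simp add: inv_mult_group m_assoc)
  ultimately show "Rep_ell2 ((W f g o\<^sub>L W f' g') \<xi>) i = Rep_ell2 (W (\<lambda>y. f y * act g f' y) (g \<otimes> g') \<xi>) i"
    using assms unfolding i
    by (simp add: W_apply linf_mult linf_act) (simp add: act_def maps)
qed

lemma adjoint_pair_W:
  assumes f: "f \<in> linf X" and g: "g \<in> carrier G"
  shows "adjoint_pair (W f g) (W (\<lambda>y. cnj (act (inv g) f y)) (inv g))"
  unfolding adjoint_pair_def
proof (intro allI)
  fix \<xi> \<eta> :: "('g \<times> 'x) ell2"
  let ?f' = "\<lambda>y. cnj (act (inv g) f y)" and ?S = "carrier G \<times> X" and ?\<tau> = "\<lambda>(k, y). (g \<otimes> k, y)"
  have f': "?f' \<in> linf X" using f g by (intro linf_cnj linf_act) auto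
  let ?u = "\<lambda>(h, y). cnj (f (\<beta> h y) * Rep_ell2 \<xi> (inv g \<otimes> h, y)) * Rep_ell2 \<eta> (h, y)"
  have "cinner_ell2 (W f g \<xi>) \<eta> = infsum ?u ?S"
    unfolding cinner_ell2_def
    by (rule infsum_cong_neutral) (auto simp: W_apply[OF f g] split: if_splits)
  also have "\<dots> = infsum (\<lambda>i. ?u (?\<tau> i)) ?S"
  proof (rule infsum_reindex_bij_betw[symmetric])
    show "bij_betw ?\<tau> ?S ?S"
      by (rule bij_betwI[of _ _ _ "\<lambda>(k, y). (inv g \<otimes> k, y)"])
        (use g in \<open>auto simp flip: m_assoc\<close>)
  qed
  also have "\<dots> = cinner_ell2 \<xi> (W ?f' (inv g) \<eta>)"
    unfolding cinner_ell2_def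
  proof (rule infsum_cong_neutral)
    fix i assume "i \<in> ?S \<inter> UNIV"
    then obtain k y where i: "i = (k, y)" and ky: "k \<in> carrier G" "y \<in> X" by auto
    have "inv g \<otimes> (g \<otimes> k) = k" using g ky by (simp flip: m_assoc)
    then show "?u (?\<tau> i) = cnj (Rep_ell2 \<xi> i) * Rep_ell2 (W ?f' (inv g) \<eta>) i"
      using f' g ky unfolding i by (simp add: W_apply) (simp add: act_def mult maps)
  qed (use f' g in \<open>auto simp: W_apply split: if_splits\<close>)
  finally show "cinner_ell2 (W f g \<xi>) \<eta> = cinner_ell2 \<xi> (W ?f' (inv g) \<eta>)" .
qed

lemma W_delta:
  assumes "f \<in> linf X" "g \<in> carrier G" "h \<in> carrier G" "y \<in> X"
  shows "Rep_ell2 (W f g (delta (h, y))) (h, y) = (if g = \<one> then f (\<beta> h y) else 0)"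
proof -
  have "inv g \<otimes> h = h \<longleftrightarrow> g = \<one>"
    using assms by (simp add: inv_eq_1_iff)
  then show ?thesis using assms by (simp add: W_apply delta.rep_eq)
qed

end

section \<open>The reduced crossed product as an algebra of operators\<close>

lemma subspace_closure:
  fixes S :: "'a::real_normed_vector set"
  assumes S: "subspace S"
  shows "subspace (closure S)"
  unfolding subspace_def
proof (intro conjI ballI allI)
  show "0 \<in> closure S" using subspace_0[OF S] closure_subset by blast
  show "x + y \<in> closure S" if "x \<in> closure S" "y \<in> closure S" for x y
  proof -
    from that obtain f g where "\<And>n. f n \<in> S" "\<And>n. g n \<in> S" "f \<longlonglongrightarrow> x" "g \<longlonglongrightarrow> y"
      unfolding closure_sequential by metis
    then have "\<forall>n. f n + g n \<in> S" "(\<lambda>n. f n + g n) \<longlonglongrightarrow> x + y"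
      by (auto intro: subspace_add[OF S] tendsto_add)
    then show ?thesis unfolding closure_sequential by (intro exI[of _ "\<lambda>n. f n + g n"]) blast
  qed
  show "c *\<^sub>R x \<in> closure S" if "x \<in> closure S" for c x
  proof -
    from that obtain f where "\<And>n. f n \<in> S" "f \<longlonglongrightarrow> x"
      unfolding closure_sequential by metis
    then have "\<forall>n. c *\<^sub>R f n \<in> S" "(\<lambda>n. c *\<^sub>R f n) \<longlonglongrightarrow> c *\<^sub>R x"
      by (auto intro: subspace_scale[OF S] tendsto_scaleR)
    then show ?thesis unfolding closure_sequential by (intro exI[of _ "\<lambda>n. c *\<^sub>R f n"]) blast
  qed
qed

locale function_system = discrete_action G X \<beta> for G :: "('g, 'r) monoid_scheme" (structure)
    and X :: "'x set" and \<beta> +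
  fixes D :: "('x \<Rightarrow> complex) set"
  assumes D_subalgebra: "linf_cstar_subalgebra X D"
    and D_invariant: "\<And>g f. g \<in> carrier G \<Longrightarrow> f \<in> D \<Longrightarrow> act g f \<in> D"
begin

abbreviation crossed :: "(('g \<times> 'x) ell2 \<Rightarrow>\<^sub>L ('g \<times> 'x) ell2) set" where
  "crossed \<equiv> reduced_crossed_product G X D act"

lemma D_linf: "f \<in> D \<Longrightarrow> f \<in> linf X"
  and D_zero: "(\<lambda>_. 0) \<in> D"
  and D_mult: "f \<in> D \<Longrightarrow> f' \<in> D \<Longrightarrow> (\<lambda>y. f y * f' y) \<in> D"
  and D_cmult: "f \<in> D \<Longrightarrow> (\<lambda>y. c * f y) \<in> D"
  and D_cnj: "f \<in> D \<Longrightarrow> (\<lambda>y. cnj (f y)) \<in> D"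
  using D_subalgebra by (auto simp: linf_cstar_subalgebra_def)

lemma crossed_eq: "crossed = closure (span {W d g | d g. d \<in> D \<and> g \<in> carrier G})"
  by (simp add: reduced_crossed_product_def W_def)

lemma W_in_crossed: "d \<in> D \<Longrightarrow> g \<in> carrier G \<Longrightarrow> W d g \<in> crossed"
  unfolding crossed_eq by (rule subsetD[OF closure_subset], rule span_base) auto

lemma crossed_subset:
  assumes "closed K" "subspace K" "\<And>d g. d \<in> D \<Longrightarrow> g \<in> carrier G \<Longrightarrow> W d g \<in> K"
  shows "crossed \<subseteq> K"
  unfolding crossed_eq using assms by (intro closure_minimal span_minimal) auto

lemma closed_crossed: "closed crossed" and subspace_crossed: "subspace crossed"
  unfolding crossed_eq by (simp_all add: subspace_closure)

text \<open>
  A bounded linear map that sends the generators into the crossed product sends all of it there.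
  Applied first to right and then to left multiplication, this gives closure under products.
\<close>

lemma linear_vimage_crossed:
  assumes F: "bounded_linear F" and gens: "\<And>d g. d \<in> D \<Longrightarrow> g \<in> carrier G \<Longrightarrow> F (W d g) \<in> crossed"
  shows "T \<in> crossed \<Longrightarrow> F T \<in> crossed"
proof -
  have "crossed \<subseteq> F -` crossed"
  proof (rule crossed_subset)
    show "closed (F -` crossed)"
      using F by (intro closed_vimage closed_crossed) (simp add: linear_continuous_on)
    show "subspace (F -` crossed)"
      using F by (intro linear_subspace_vimage bounded_linear.linear subspace_crossed)
  qed (use gens in auto)
  then show "T \<in> crossed \<Longrightarrow> F T \<in> crossed" by auto
qed

lemma crossed_compose:
  assumes "S \<in> crossed" "T \<in> crossed"
  shows "S o\<^sub>L T \<in> crossed"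
proof -
  have gens: "W d g o\<^sub>L W d' g' \<in> crossed"
    if "d \<in> D" "g \<in> carrier G" "d' \<in> D" "g' \<in> carrier G" for d d' g g'
    using that by (simp add: W_mult D_linf W_in_crossed D_mult D_invariant)
  have "S' o\<^sub>L W d' g' \<in> crossed" if "d' \<in> D" "g' \<in> carrier G" "S' \<in> crossed" for S' d' g'
    using linear_vimage_crossed[OF bounded_bilinear.bounded_linear_left[OF bounded_bilinear_blinfun_compose]]
      gens that by blast
  then show ?thesis
    using linear_vimage_crossed[OF bounded_bilinear.bounded_linear_right[OF bounded_bilinear_blinfun_compose]]
      assms by blast
qed

lemma crossed_has_adjoint:
  assumes "T \<in> crossed"
  shows "\<exists>S\<in>crossed. adjoint_pair T S"
proof -
  have "crossed \<subseteq> {T. \<exists>S\<in>crossed. adjoint_pair T S}"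
  proof (rule crossed_subset)
    show "closed {T. \<exists>S\<in>crossed. adjoint_pair T S}"
      by (rule closed_has_adjoint_in[OF closed_crossed])
    show "subspace {T. \<exists>S\<in>crossed. adjoint_pair T S}"
      unfolding subspace_def
    proof (intro conjI ballI allI)
      have "adjoint_pair (0 :: ('g \<times> 'x) ell2 \<Rightarrow>\<^sub>L ('g \<times> 'x) ell2) 0"
        using adjoint_pair_W[OF linf_zero one_closed] by (simp add: act_def W_zero)
      then show "0 \<in> {T. \<exists>S\<in>crossed. adjoint_pair T S}"
        using subspace_0[OF subspace_crossed] by blast
    qed (auto intro: subspace_add[OF subspace_crossed] adjoint_pair_add
        subspace_scale[OF subspace_crossed] adjoint_pair_scaleR)
    show "W d g \<in> {T. \<exists>S\<in>crossed. adjoint_pair T S}" if "d \<in> D" "g \<in> carrier G" for d g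
      using that adjoint_pair_W[of d g] W_in_crossed[OF D_cnj[OF D_invariant]] D_linf by blast
  qed
  then show ?thesis using assms by blast
qed

sublocale operator_star_algebra crossed
  by unfold_locales (simp_all add: closed_crossed subspace_crossed crossed_compose crossed_has_adjoint)

lemma cstar_algebra_crossed: "cstar_algebra crossed"
proof -
  have "crossed \<subseteq> {T. clinear_op T}"
  proof (rule crossed_subset)
    have "{T :: ('g \<times> 'x) ell2 \<Rightarrow>\<^sub>L ('g \<times> 'x) ell2. clinear_op T}
        = {T. \<forall>c x. blinfun_apply T (scaleC_ell2 c x) = scaleC_ell2 c (T x)}"
      by (simp add: clinear_op_def)
    also have "closed \<dots>"
      by (intro closed_Collect_all closed_Collect_eq linear_continuous_on
          bounded_linear_compose[OF bounded_linear_scaleC] blinfun.bounded_linear_left)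
    finally show "closed {T :: ('g \<times> 'x) ell2 \<Rightarrow>\<^sub>L ('g \<times> 'x) ell2. clinear_op T}" .
    show "subspace {T :: ('g \<times> 'x) ell2 \<Rightarrow>\<^sub>L ('g \<times> 'x) ell2. clinear_op T}"
      unfolding subspace_def clinear_op_def
      by (auto simp: blinfun.add_left blinfun.scaleR_left bounded_linear.linear[OF bounded_linear_scaleC]
          linear_0 linear_add linear_scale)
    show "W d g \<in> {T. clinear_op T}" if "d \<in> D" "g \<in> carrier G" for d g
      unfolding clinear_op_def mem_Collect_eq using that D_linf
      by (auto intro!: ell2_eqI simp: W_apply scaleC_ell2.rep_eq)
  qed
  moreover have "cscale_op c o\<^sub>L T \<in> crossed" if "T \<in> crossed" for c T
    using linear_vimage_crossed[OF bounded_bilinear.bounded_linear_right[OF bounded_bilinear_blinfun_compose], OF _ that]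
      W_scaleC[OF D_linf, symmetric] W_in_crossed[OF D_cmult] by metis
  ultimately show ?thesis
    unfolding cstar_algebra_def by (auto simp: closed subspace compose adj_in)
qed

lemma crossed_vanishes_outside:
  assumes "T \<in> crossed" "i \<notin> carrier G \<times> X"
  shows "T (delta i) = 0"
proof -
  have "crossed \<subseteq> {T. blinfun_apply T (delta i) = 0}"
  proof (rule crossed_subset)
    show "closed {T. blinfun_apply T (delta i) = 0}"
      by (intro closed_Collect_eq linear_continuous_on blinfun.bounded_linear_left continuous_on_const)
    show "subspace {T. blinfun_apply T (delta i) = 0}"
      by (auto simp: subspace_def blinfun.add_left blinfun.scaleR_left)
    show "W d g \<in> {T. blinfun_apply T (delta i) = 0}" if "d \<in> D" "g \<in> carrier G" for d g
      using that D_linf assms(2)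
      by (auto intro!: ell2_eqI simp: W_apply delta.rep_eq zero_ell2.rep_eq)
  qed
  then show ?thesis using assms(1) by auto
qed

text \<open>
  A nonzero element does not kill every basis vector: otherwise its adjoint would map every vector
  to one with vanishing coordinates.
\<close>

lemma crossed_nonzero_at_delta:
  assumes b: "b \<in> crossed" "b \<noteq> 0"
  obtains h y where "h \<in> carrier G" "y \<in> X" "b (delta (h, y)) \<noteq> 0"
proof -
  have "\<exists>i. b (delta i) \<noteq> 0"
  proof (rule ccontr)
    assume "\<nexists>i. b (delta i) \<noteq> 0"
    then have z: "b (delta i) = 0" for i by blast
    have "adj b \<eta> = 0" for \<eta>
    proof (rule ell2_eqI)
      fix i
      have "Rep_ell2 (adj b \<eta>) i = cinner_ell2 (b (delta i)) \<eta>"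
        using adjoint_pair_adj[OF b(1)] by (simp add: adjoint_pair_def cinner_delta)
      then show "Rep_ell2 (adj b \<eta>) i = Rep_ell2 0 i"
        by (simp add: z cinner_ell2_def zero_ell2.rep_eq)
    qed
    then have "adj b = 0" by (intro blinfun_eqI) simp
    moreover have "norm b \<le> norm (adj b)"
      by (rule norm_adjoint_le[OF adjoint_pair_sym[OF adjoint_pair_adj[OF b(1)]]])
    ultimately show False using b(2) by simp
  qed
  then show ?thesis using that crossed_vanishes_outside[OF b(1)] by (metis mem_Sigma_iff surj_pair)
qed

end

section \<open>Actions with a transitive family of basic clopen sets\<close>

text \<open>
  The sets in \<open>\<C>\<close> form a base of clopen sets for a topology on \<open>X\<close>, and the action permutes them
  transitively. The conditions \<open>free\<close> and \<open>compressible\<close> are the dynamical input: the fixed points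
  of a nontrivial group element form a set with empty interior, and, in view of transitivity, some
  basic set properly contains a translate of itself.
\<close>

locale clopen_family = discrete_action G X \<beta> for G :: "('g, 'r) monoid_scheme" (structure)
    and X :: "'x set" and \<beta> +
  fixes \<C> :: "'x set set"
  assumes basic_subset: "\<And>C. C \<in> \<C> \<Longrightarrow> C \<subseteq> X"
    and nonempty: "\<And>C. C \<in> \<C> \<Longrightarrow> C \<noteq> {}"
    and image: "\<And>g C. g \<in> carrier G \<Longrightarrow> C \<in> \<C> \<Longrightarrow> \<beta> g ` C \<in> \<C>"
    and transitive: "\<And>C C'. C \<in> \<C> \<Longrightarrow> C' \<in> \<C> \<Longrightarrow> \<exists>g\<in>carrier G. \<beta> g ` C = C'"
    and directed: "\<And>C C' x. C \<in> \<C> \<Longrightarrow> C' \<in> \<C> \<Longrightarrow> x \<in> C \<inter> C' \<Longrightarrow> \<exists>E\<in>\<C>. x \<in> E \<and> E \<subseteq> C \<inter> C'"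
    and cover: "\<And>x. x \<in> X \<Longrightarrow> \<exists>C\<in>\<C>. x \<in> C"
    and clopen: "\<And>C x. C \<in> \<C> \<Longrightarrow> x \<in> X - C \<Longrightarrow> \<exists>E\<in>\<C>. x \<in> E \<and> E \<inter> C = {}"
    and free: "\<And>g C. g \<in> carrier G \<Longrightarrow> g \<noteq> \<one> \<Longrightarrow> C \<in> \<C> \<Longrightarrow>
      \<exists>E\<in>\<C>. E \<subseteq> C \<and> E \<inter> \<beta> g ` E = {}"
    and compressible: "\<exists>C\<in>\<C>. \<exists>E\<in>\<C>. E \<subset> C"
begin

definition D :: "('x \<Rightarrow> complex) set" where
  "D = linf_cstar_generated X (indicator ` \<C>)"

lemma D_subalg: "linf_cstar_subalgebra X D"
  unfolding D_def
  by (rule linf_cstar_subalgebra_generated) (auto intro: linf_indicator dest: basic_subset)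

lemma indicator_in_D: "C \<in> \<C> \<Longrightarrow> indicator C \<in> D"
  unfolding D_def using linf_cstar_generated_superset by blast

lemma uniform_limit_act:
  assumes "uniform_limit X F f sequentially" "g \<in> carrier G"
  shows "uniform_limit X (\<lambda>n. act g (F n)) (act g f) sequentially"
proof (rule uniform_limitI)
  fix e :: real assume "0 < e"
  from uniform_limitD[OF assms(1) this]
  show "\<forall>\<^sub>F n in sequentially. \<forall>x\<in>X. dist (act g (F n) x) (act g f x) < e"
    by (rule eventually_mono) (use assms(2) in \<open>auto simp: act_def maps\<close>)
qed

lemma D_act:
  assumes "f \<in> D" "g \<in> carrier G"
  shows "act g f \<in> D"
proof -
  note S = D_subalg[unfolded linf_cstar_subalgebra_def]
  have "D \<subseteq> {f \<in> D. act g f \<in> D}"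
  proof (subst (1) D_def, rule linf_cstar_generated_least)
    show "linf_cstar_subalgebra X {f \<in> D. act g f \<in> D}"
      unfolding linf_cstar_subalgebra_def
    proof (intro conjI ballI allI impI)
      show "{f \<in> D. act g f \<in> D} \<subseteq> linf X" using S by auto
      show "(\<lambda>_. 0) \<in> {f \<in> D. act g f \<in> D}" using S by (auto simp: act_def)
      fix f assume f: "f \<in> {f \<in> D. act g f \<in> D}"
      have eqs: "act g (\<lambda>y. c * f y) = (\<lambda>y. c * act g f y)" "act g (\<lambda>y. cnj (f y)) = (\<lambda>y. cnj (act g f y))"
        "act g (\<lambda>y. f y + f' y) = (\<lambda>y. act g f y + act g f' y)"
        "act g (\<lambda>y. f y * f' y) = (\<lambda>y. act g f y * act g f' y)" for c f'
        by (auto simp: act_def fun_eq_iff)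
      show "(\<lambda>y. c * f y) \<in> {f \<in> D. act g f \<in> D}" for c
        using f S by (auto simp: eqs)
      show "(\<lambda>y. cnj (f y)) \<in> {f \<in> D. act g f \<in> D}"
        using f S by (auto simp: eqs)
      show "(\<lambda>y. f y + f' y) \<in> {f \<in> D. act g f \<in> D}" "(\<lambda>y. f y * f' y) \<in> {f \<in> D. act g f \<in> D}"
        if "f' \<in> {f \<in> D. act g f \<in> D}" for f'
        using f that S by (auto simp: eqs)
    next
      fix F f assume f: "f \<in> linf X"
        and F: "(\<forall>n. F n \<in> {f \<in> D. act g f \<in> D}) \<and> uniform_limit X F f sequentially"
      have lim: "f \<in> D" if "f \<in> linf X" "\<And>n. F n \<in> D" "uniform_limit X F f sequentially" for F f
        using S that by blast
      show "f \<in> {f \<in> D. act g f \<in> D}"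
        using lim[of f F] lim[of "act g f" "\<lambda>n. act g (F n)"] f F linf_act[OF f assms(2)]
          uniform_limit_act[OF _ assms(2)] by auto
    qed
    show "indicator ` \<C> \<subseteq> {f \<in> D. act g f \<in> D}"
      using assms(2) by (auto simp: act_indicator basic_subset image indicator_in_D)
  qed
  then show ?thesis using assms(1) by auto
qed

sublocale function_system G X \<beta> D
  by unfold_locales (simp_all add: D_subalg D_act)

text \<open>The neighbourhood filter of \<open>x\<close> in the topology with base \<open>\<C>\<close>.\<close>

definition nbhd :: "'x \<Rightarrow> 'x filter" where
  "nbhd x = (INF C\<in>{C \<in> \<C>. x \<in> C}. principal C)"

lemma eventually_nbhd:
  assumes "x \<in> X"
  shows "eventually P (nbhd x) \<longleftrightarrow> (\<exists>C\<in>\<C>. x \<in> C \<and> (\<forall>y\<in>C. P y))"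
  unfolding nbhd_def
proof (subst eventually_INF_base)
  show "{C \<in> \<C>. x \<in> C} \<noteq> {}" using cover assms by auto
  show "\<exists>E\<in>{C \<in> \<C>. x \<in> C}. principal E \<le> inf (principal C) (principal C')"
    if "C \<in> {C \<in> \<C>. x \<in> C}" "C' \<in> {C \<in> \<C>. x \<in> C}" for C C'
    using directed[of C C' x] that by auto
qed (auto simp: eventually_principal)

text \<open>
  Elements of \<open>D\<close> are continuous: this holds for indicators of clopen sets and is inherited by
  algebraic combinations and uniform limits.
\<close>

lemma D_continuous:
  assumes "d \<in> D" "x \<in> X"
  shows "(d \<longlongrightarrow> d x) (nbhd x)"
proof -
  let ?K = "{f \<in> linf X. (f \<longlongrightarrow> f x) (nbhd x)}"
  have "D \<subseteq> ?K"
    unfolding D_def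
  proof (rule linf_cstar_generated_least)
    show "linf_cstar_subalgebra X ?K"
      unfolding linf_cstar_subalgebra_def
    proof (intro conjI ballI allI impI)
      fix F f assume f: "f \<in> linf X" and F: "(\<forall>n. F n \<in> ?K) \<and> uniform_limit X F f sequentially"
      have "(f \<longlongrightarrow> f x) (nbhd x)"
      proof (rule tendstoI)
        fix e :: real assume "0 < e"
        then have e3: "0 < e / 3" by simp
        from F obtain n where n: "\<And>y. y \<in> X \<Longrightarrow> dist (F n y) (f y) < e / 3"
          using uniform_limitD[OF _ e3] eventually_happens by (metis (mono_tags, lifting) sequentially_bot)
        have "eventually (\<lambda>y. dist (F n y) (F n x) < e / 3) (nbhd x)"
          using F tendstoD[OF _ e3] by blast
        moreover have "eventually (\<lambda>y. y \<in> X) (nbhd x)"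
          using cover[OF assms(2)] basic_subset by (auto simp: eventually_nbhd[OF assms(2)])
        ultimately show "eventually (\<lambda>y. dist (f y) (f x) < e) (nbhd x)"
        proof eventually_elim
          case (elim y)
          then show ?case
            using n[of y] n[OF assms(2)] dist_triangle_third[of "f y" "F n y" e "F n x" "f x"]
            by (simp add: dist_commute)
        qed
      qed
      then show "f \<in> ?K" using f by simp
    qed (auto intro: linf_zero linf_add linf_mult linf_cmult linf_cnj tendsto_intros)
    show "indicator ` \<C> \<subseteq> ?K"
    proof (clarify, intro conjI)
      fix C assume C: "C \<in> \<C>"
      show "(indicator C :: 'x \<Rightarrow> complex) \<in> linf X" using C by (intro linf_indicator basic_subset)
      have "eventually (\<lambda>y. (indicator C y :: complex) = indicator C x) (nbhd x)"
      proof (cases "x \<in> C")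
        case True
        with C show ?thesis by (auto simp: eventually_nbhd[OF assms(2)] intro!: bexI[of _ C])
      next
        case False
        then obtain E where "E \<in> \<C>" "x \<in> E" "E \<inter> C = {}" using clopen[OF C] assms(2) by auto
        with False show ?thesis
          by (auto simp: eventually_nbhd[OF assms(2)] indicator_def intro!: bexI[of _ E])
      qed
      then show "((indicator C :: 'x \<Rightarrow> complex) \<longlongrightarrow> indicator C x) (nbhd x)"
        by (rule tendsto_eventually)
    qed
  qed
  then show ?thesis using assms(1) by auto
qed

section \<open>Compression to small basic sets\<close>

definition P :: "'x set \<Rightarrow> (('g \<times> 'x) ell2 \<Rightarrow>\<^sub>L ('g \<times> 'x) ell2)" where
  "P C = W (indicator C) \<one>"

lemma cnj_indicator: "(\<lambda>y. cnj (indicator C y)) = (indicator C :: 'x \<Rightarrow> complex)"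
  by (auto simp: indicator_def)

lemma indicator_linf: "C \<in> \<C> \<Longrightarrow> indicator C \<in> linf X"
  by (intro linf_indicator basic_subset)

lemma P_in_crossed: "C \<in> \<C> \<Longrightarrow> P C \<in> crossed"
  unfolding P_def by (intro W_in_crossed indicator_in_D) auto

lemma norm_P_le: "C \<in> \<C> \<Longrightarrow> norm (P C) \<le> 1"
  unfolding P_def by (rule norm_W_le) (auto simp: indicator_linf indicator_def)

lemma W_P:
  assumes "f \<in> linf X" "g \<in> carrier G" "C \<in> \<C>"
  shows "W f g o\<^sub>L P C = W (\<lambda>y. f y * indicator (\<beta> g ` C) y) g"
  unfolding P_def using assms by (simp add: W_mult indicator_linf act_indicator basic_subset)

lemma P_W:
  assumes "f \<in> linf X" "g \<in> carrier G" "C \<in> \<C>"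
  shows "P C o\<^sub>L W f g = W (\<lambda>y. indicator C y * f y) g"
  unfolding P_def using assms by (simp add: W_mult indicator_linf act_one)

lemma image_one: "C \<in> \<C> \<Longrightarrow> \<beta> \<one> ` C = C"
  using basic_subset one by force

lemma P_P: "C \<in> \<C> \<Longrightarrow> E \<in> \<C> \<Longrightarrow> E \<subseteq> C \<Longrightarrow> P C o\<^sub>L P E = P E"
  and P_P': "C \<in> \<C> \<Longrightarrow> E \<in> \<C> \<Longrightarrow> E \<subseteq> C \<Longrightarrow> P E o\<^sub>L P C = P E"
  by (unfold P_def[of E], simp_all add: P_W W_P indicator_linf image_one)
    (auto intro!: arg_cong[of _ _ "\<lambda>f. W f \<one>"] simp: indicator_def fun_eq_iff)

lemma adj_P: "C \<in> \<C> \<Longrightarrow> adj (P C) = P C"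
  unfolding P_def
  using adj_eq[OF adjoint_pair_W[OF indicator_linf one_closed]]
  by (simp add: act_one indicator_linf cnj_indicator)

lemma projection_P: "C \<in> \<C> \<Longrightarrow> projection (P C)"
  unfolding projection_def by (simp add: P_P adj_P)

lemma P_inj:
  assumes "C \<in> \<C>" "E \<in> \<C>" "P C = P E"
  shows "C = E"
proof -
  have "y \<in> C \<longleftrightarrow> y \<in> E" if "y \<in> X" for y
    using W_delta[OF indicator_linf[OF assms(1)], of \<one> \<one> y] W_delta[OF indicator_linf[OF assms(2)], of \<one> \<one> y]
      that assms(3) one[OF that] by (simp add: P_def indicator_def of_bool_eq_iff)
  then show ?thesis using assms basic_subset by blast
qed

lemma P_nonzero: "C \<in> \<C> \<Longrightarrow> P C \<noteq> 0"
proof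
  assume C: "C \<in> \<C>" "P C = 0"
  then obtain y where y: "y \<in> C" "y \<in> X" using nonempty basic_subset by blast
  show False
    using W_delta[OF indicator_linf[OF C(1)], of \<one> \<one> y] y C(2) one[OF y(2)]
    by (simp add: P_def zero_ell2.rep_eq)
qed

text \<open>The operator \<open>\<lambda>\<^sub>g \<chi>\<^sub>C\<close> implements an equivalence between the projections of \<open>C\<close> and \<open>gC\<close>.\<close>

lemma partial_isometry_between:
  assumes "C \<in> \<C>" "g \<in> carrier G"
  defines "v \<equiv> W (indicator (\<beta> g ` C)) g"
  shows "v \<in> crossed" "adj v o\<^sub>L v = P C" "v o\<^sub>L adj v = P (\<beta> g ` C)" "v o\<^sub>L P C o\<^sub>L adj v = P (\<beta> g ` C)"
proof -
  let ?E = "\<beta> g ` C"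
  have E: "?E \<in> \<C>" using assms by (intro image)
  have pulled_back: "act (inv g) (indicator ?E) = indicator C"
  proof -
    have "\<beta> (inv g) ` ?E = C"
      using assms(2) inverse_left basic_subset[OF assms(1)] by (force simp: image_image)
    then show ?thesis using act_indicator[of "inv g" ?E] E assms(2) basic_subset by simp
  qed
  have av: "adj v = W (indicator C) (inv g)"
    unfolding v_def using adj_eq[OF adjoint_pair_W[OF indicator_linf[OF E] assms(2)]] pulled_back
    by (simp add: cnj_indicator)
  have idem: "(\<lambda>y. indicator S y * indicator S y) = (indicator S :: 'x \<Rightarrow> complex)" for S
    by (auto simp: indicator_def)
  show "v \<in> crossed" unfolding v_def by (intro W_in_crossed indicator_in_D E assms)
  show "adj v o\<^sub>L v = P C"
    unfolding av P_def unfolding v_def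
    using assms(1,2) E by (simp add: W_mult indicator_linf pulled_back idem)
  show vv: "v o\<^sub>L adj v = P ?E"
    unfolding av P_def unfolding v_def
    using assms(1,2) E by (simp add: W_mult indicator_linf act_indicator basic_subset idem)
  have "v o\<^sub>L P C = v"
    unfolding v_def using assms(1,2) E by (simp add: W_P indicator_linf idem)
  then show "v o\<^sub>L P C o\<^sub>L adj v = P ?E" using vv by simp
qed

text \<open>
  The compression of \<open>T\<close> to \<open>E\<close>, minus the diagonal coefficient \<open>E(T)(x)\<close> of \<open>T\<close> at
  \<open>x = \<beta>\<^sub>h(y)\<close> times the projection of \<open>E\<close>.
\<close>

definition defect :: "'g \<Rightarrow> 'x \<Rightarrow> 'x set \<Rightarrow> (('g \<times> 'x) ell2 \<Rightarrow>\<^sub>L ('g \<times> 'x) ell2)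
    \<Rightarrow> (('g \<times> 'x) ell2 \<Rightarrow>\<^sub>L ('g \<times> 'x) ell2)" where
  "defect h y E T =
    (P E o\<^sub>L T o\<^sub>L P E) - W (\<lambda>z. Rep_ell2 (T (delta (h, y))) (h, y) * indicator E z) \<one>"

lemma defect_add: "E \<in> \<C> \<Longrightarrow> defect h y E (S + T) = defect h y E S + defect h y E T"
  by (simp add: defect_def compose_simps blinfun.add_left plus_ell2.rep_eq distrib_right W_add
      linf_cmult indicator_linf)

lemma defect_scaleR: "E \<in> \<C> \<Longrightarrow> defect h y E (r *\<^sub>R T) = r *\<^sub>R defect h y E T"
  by (simp add: defect_def compose_simps blinfun.scaleR_left scaleR_ell2.rep_eq mult.assoc W_scaleR
      linf_cmult indicator_linf scaleR_diff_right)

lemma norm_defect_le: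
  assumes E: "E \<in> \<C>"
  shows "norm (defect h y E T) \<le> 2 * norm T"
proof -
  have "norm (P E o\<^sub>L T o\<^sub>L P E) \<le> 1 * norm T * 1"
    by (intro order_trans[OF norm_blinfun_compose] mult_mono norm_P_le E) auto
  moreover have "norm (W (\<lambda>z. Rep_ell2 (T (delta (h, y))) (h, y) * indicator E z) \<one>) \<le> norm T"
  proof (rule norm_W_le)
    have "cmod (Rep_ell2 (T (delta (h, y))) (h, y)) \<le> norm T"
      using norm_coordinate_le[of "T (delta (h, y))" "(h, y)"] norm_blinfun[of T "delta (h, y)"]
      by (simp add: norm_delta)
    then show "cmod (Rep_ell2 (T (delta (h, y))) (h, y) * indicator E z) \<le> norm T" for z
      by (simp add: indicator_def)
  qed (use E in \<open>auto intro: linf_cmult indicator_linf\<close>)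
  ultimately show ?thesis
    unfolding defect_def using norm_triangle_ineq4 by (smt (verit, best))
qed

lemma defect_shrink:
  assumes "C \<in> \<C>" "E \<in> \<C>" "E \<subseteq> C"
  shows "norm (defect h y E T) \<le> norm (defect h y C T)"
proof -
  let ?c = "Rep_ell2 (T (delta (h, y))) (h, y)"
  have "P E o\<^sub>L W (\<lambda>z. ?c * indicator C z) \<one> o\<^sub>L P E = W (\<lambda>z. ?c * indicator E z) \<one>"
  proof -
    have *: "(\<lambda>z. indicator E z * (?c * indicator C z) * indicator E z) = (\<lambda>z. ?c * indicator E z)"
      using assms(3) by (auto simp: indicator_def fun_eq_iff)
    show ?thesis
      using assms by (simp add: P_W W_P linf_cmult linf_mult indicator_linf image_one *)
  qed
  moreover have "P E o\<^sub>L (P C o\<^sub>L T o\<^sub>L P C) o\<^sub>L P E = P E o\<^sub>L T o\<^sub>L P E"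
    using P_P[OF assms] P_P'[OF assms] by (metis blinfun_compose_assoc)
  ultimately have "defect h y E T = P E o\<^sub>L defect h y C T o\<^sub>L P E"
    by (simp add: defect_def compose_simps)
  also have "norm \<dots> \<le> 1 * norm (defect h y C T) * 1"
    by (intro order_trans[OF norm_blinfun_compose] mult_mono norm_P_le assms) auto
  finally show ?thesis by simp
qed

text \<open>
  Every element of the crossed product becomes almost scalar after compression to a suitable basic
  set near \<open>x\<close>. For \<open>\<pi>(d)\<close> this is continuity of \<open>d\<close>; for \<open>\<pi>(d) \<lambda>\<^sub>g\<close> with \<open>g \<noteq> 1\<close> the
  compression to a set disjoint from its translate by \<open>g\<close> vanishes. Such sets exist only near \<open>x\<close>
  and need not contain it; with the quantifiers arranged as below the property survives sums.
\<close>

lemma compression_almost_scalar: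
  assumes T: "T \<in> crossed" and h: "h \<in> carrier G" and y: "y \<in> X" and e: "0 < e"
  shows "\<exists>C\<in>\<C>. \<beta> h y \<in> C \<and> (\<forall>C'\<in>\<C>. C' \<subseteq> C \<longrightarrow> (\<exists>E\<in>\<C>. E \<subseteq> C' \<and> norm (defect h y E T) \<le> e))"
proof -
  define x where "x = \<beta> h y"
  have x: "x \<in> X" unfolding x_def using h y by (rule maps)
  define Q where "Q e T \<longleftrightarrow>
    (\<exists>C\<in>\<C>. x \<in> C \<and> (\<forall>C'\<in>\<C>. C' \<subseteq> C \<longrightarrow> (\<exists>E\<in>\<C>. E \<subseteq> C' \<and> norm (defect h y E T) \<le> e)))" for e T
  have QI: "Q e T" if "C \<in> \<C>" "x \<in> C"
    "\<And>C'. C' \<in> \<C> \<Longrightarrow> C' \<subseteq> C \<Longrightarrow> \<exists>E\<in>\<C>. E \<subseteq> C' \<and> norm (defect h y E T) \<le> e" for C e T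
    unfolding Q_def using that by blast
  have Q_add: "Q (a + b) (S + T)" if S: "Q a S" and T: "Q b T" for a b S T
  proof -
    obtain C where C: "C \<in> \<C>" "x \<in> C"
      "\<And>C'. C' \<in> \<C> \<Longrightarrow> C' \<subseteq> C \<Longrightarrow> \<exists>E\<in>\<C>. E \<subseteq> C' \<and> norm (defect h y E S) \<le> a"
      using S unfolding Q_def by blast
    obtain B where B: "B \<in> \<C>" "x \<in> B"
      "\<And>C'. C' \<in> \<C> \<Longrightarrow> C' \<subseteq> B \<Longrightarrow> \<exists>E\<in>\<C>. E \<subseteq> C' \<and> norm (defect h y E T) \<le> b"
      using T unfolding Q_def by blast
    obtain F where F: "F \<in> \<C>" "x \<in> F" "F \<subseteq> C \<inter> B" using directed[of C B x] C B by auto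
    show ?thesis
    proof (rule QI[OF F(1,2)])
      fix C' assume C': "C' \<in> \<C>" "C' \<subseteq> F"
      then obtain E where E: "E \<in> \<C>" "E \<subseteq> C'" "norm (defect h y E S) \<le> a"
        using C(3) F(3) by blast
      then obtain E' where E': "E' \<in> \<C>" "E' \<subseteq> E" "norm (defect h y E' T) \<le> b"
        using B(3) F(3) C' by blast
      have "norm (defect h y E' (S + T)) \<le> a + b"
        unfolding defect_add[OF E'(1)]
        using norm_triangle_mono[OF order_trans[OF defect_shrink[OF E(1) E'(1,2)] E(3)] E'(3)] .
      with E E' show "\<exists>E\<in>\<C>. E \<subseteq> C' \<and> norm (defect h y E (S + T)) \<le> a + b" by blast
    qed
  qed
  have Q_small: "Q e T" if "2 * norm T \<le> e" for e T
  proof -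
    obtain C where C: "C \<in> \<C>" "x \<in> C" using cover[OF x] by blast
    show ?thesis
      by (rule QI[OF C]) (use order_trans[OF norm_defect_le that] in blast)
  qed
  have "crossed \<subseteq> {T. \<forall>e>0. Q e T}"
  proof (rule crossed_subset)
    show "closed {T. \<forall>e>0. Q e T}"
      unfolding closed_sequential_limits
    proof (intro allI impI, elim conjE)
      fix F T assume F: "\<forall>n. F n \<in> {T. \<forall>e>0. Q e T}" and lim: "F \<longlonglongrightarrow> T"
      have "Q e T" if e: "0 < e" for e
      proof -
        obtain n where "norm (F n - T) < e / 4"
          using LIMSEQ_D[OF lim, of "e / 4"] e by auto
        then have "Q (e / 2) (T - F n)" by (intro Q_small) (simp add: norm_minus_commute)
        moreover have "Q (e / 2) (F n)" using F e by simp
        ultimately show ?thesis using Q_add[of "e / 2" "F n" "e / 2" "T - F n"] by simp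
      qed
      then show "T \<in> {T. \<forall>e>0. Q e T}" by blast
    qed
    show "subspace {T. \<forall>e>0. Q e T}"
      unfolding subspace_def
    proof (intro conjI ballI allI)
      show "0 \<in> {T. \<forall>e>0. Q e T}" using Q_small[of 0] by simp
      show "S + T \<in> {T. \<forall>e>0. Q e T}" if "S \<in> {T. \<forall>e>0. Q e T}" "T \<in> {T. \<forall>e>0. Q e T}" for S T
      proof (clarify)
        fix e :: real assume "0 < e"
        then show "Q e (S + T)" using that Q_add[of "e / 2" S "e / 2" T] by simp
      qed
      show "c *\<^sub>R T \<in> {T. \<forall>e>0. Q e T}" if T: "T \<in> {T. \<forall>e>0. Q e T}" for c T
      proof (clarify)
        fix e :: real assume e: "0 < e"
        show "Q e (c *\<^sub>R T)"
        proof (cases "c = 0")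
          case True
          then show ?thesis using Q_small[of 0 e] e by simp
        next
          case False
          then have "Q (e / \<bar>c\<bar>) T" using T e by simp
          then obtain C where C: "C \<in> \<C>" "x \<in> C"
            "\<And>C'. C' \<in> \<C> \<Longrightarrow> C' \<subseteq> C \<Longrightarrow> \<exists>E\<in>\<C>. E \<subseteq> C' \<and> norm (defect h y E T) \<le> e / \<bar>c\<bar>"
            unfolding Q_def by blast
          show ?thesis
          proof (rule QI[OF C(1,2)])
            fix C' assume "C' \<in> \<C>" "C' \<subseteq> C"
            then obtain E where "E \<in> \<C>" "E \<subseteq> C'" "norm (defect h y E T) \<le> e / \<bar>c\<bar>" using C(3) by blast
            then show "\<exists>E\<in>\<C>. E \<subseteq> C' \<and> norm (defect h y E (c *\<^sub>R T)) \<le> e"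
              using False by (intro bexI[of _ E]) (auto simp: defect_scaleR field_simps)
          qed
        qed
      qed
    qed
    fix d g assume d: "d \<in> D" and g: "g \<in> carrier G"
    have dl: "d \<in> linf X" using d by (rule D_linf)
    have comp: "P E o\<^sub>L W d g o\<^sub>L P E = W (\<lambda>z. indicator E z * d z * indicator (\<beta> g ` E) z) g"
      if "E \<in> \<C>" for E
      using that dl g by (simp add: P_W W_P linf_mult indicator_linf)
    have "Q e (W d g)" if e: "0 < e" for e
    proof (cases "g = \<one>")
      case True
      have coeff: "Rep_ell2 (W d g (delta (h, y))) (h, y) = d x"
        using W_delta[OF dl g h y] True by (simp add: x_def)
      obtain C where C: "C \<in> \<C>" "x \<in> C" "\<And>z. z \<in> C \<Longrightarrow> dist (d z) (d x) < e"
        using tendstoD[OF D_continuous[OF d x] e] by (auto simp: eventually_nbhd[OF x])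
      show ?thesis
      proof (rule QI[OF C(1,2)])
        fix E assume E: "E \<in> \<C>" "E \<subseteq> C"
        have "defect h y E (W d g)
            = W (\<lambda>z. indicator E z * d z * indicator E z - d x * indicator E z) \<one>"
          using E dl True g
          by (simp add: defect_def coeff[unfolded True] comp[unfolded True] image_one W_diff linf_mult linf_cmult indicator_linf)
        also have "norm \<dots> \<le> e"
          using E dl e C(3) by (intro norm_W_le linf_diff linf_mult linf_cmult indicator_linf)
            (auto simp: indicator_def dist_norm intro: less_imp_le)
        finally show "\<exists>E'\<in>\<C>. E' \<subseteq> E \<and> norm (defect h y E' (W d g)) \<le> e" using E by blast
      qed
    next
      case False
      have coeff: "Rep_ell2 (W d g (delta (h, y))) (h, y) = 0"
        using W_delta[OF dl g h y] False by simp
      obtain C where C: "C \<in> \<C>" "x \<in> C" using cover[OF x] by blast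
      show ?thesis
      proof (rule QI[OF C])
        fix C' assume "C' \<in> \<C>"
        then obtain E where E: "E \<in> \<C>" "E \<subseteq> C'" "E \<inter> \<beta> g ` E = {}" using free[OF g False] by blast
        have "(\<lambda>z. indicator E z * d z * indicator (\<beta> g ` E) z) = (\<lambda>_. 0)"
          using E(3) by (auto simp: indicator_def fun_eq_iff)
        then have "defect h y E (W d g) = 0"
          using E g by (simp add: defect_def coeff comp W_zero)
        with E e show "\<exists>E\<in>\<C>. E \<subseteq> C' \<and> norm (defect h y E (W d g)) \<le> e"
          by (intro bexI[of _ E]) auto
      qed
    qed
    then show "W d g \<in> {T. \<forall>e>0. Q e T}" by blast
  qed
  then show ?thesis using T e unfolding Q_def x_def by blast
qed

text \<open>
  If \<open>b \<noteq> 0\<close>, some diagonal coefficient \<open>r = \<parallel>b \<delta>\<parallel>\<^sup>2\<close> of \<open>b*b\<close> is positive. Compressing to a small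
  basic set makes \<open>b*b\<close> nearly \<open>r\<close> there, hence invertible in that corner.
\<close>

lemma basic_projection_below:
  assumes b: "b \<in> crossed" "b \<noteq> 0"
  obtains d C where "d \<in> crossed" "C \<in> \<C>" "adj (b o\<^sub>L d) o\<^sub>L (b o\<^sub>L d) = P C"
proof -
  obtain h y where hy: "h \<in> carrier G" "y \<in> X" and nz: "b (delta (h, y)) \<noteq> 0"
    using crossed_nonzero_at_delta[OF b] by blast
  define r where "r = (norm (b (delta (h, y))))\<^sup>2"
  have r: "0 < r" using nz by (simp add: r_def)
  let ?T = "adj b o\<^sub>L b"
  have T: "?T \<in> crossed" by (intro compose adj_in b)
  have "Rep_ell2 (?T (delta (h, y))) (h, y) = cinner_ell2 (b (delta (h, y))) (b (delta (h, y)))"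
    using adjoint_pair_adj[OF b(1)] by (simp add: adjoint_pair_def flip: cinner_delta)
  also have "\<dots> = complex_of_real r"
    by (simp add: r_def cinner_ell2_self norm_ell2_sq)
  finally have coeff: "Rep_ell2 (?T (delta (h, y))) (h, y) = complex_of_real r" .
  have "0 < r / 2" using r by simp
  from compression_almost_scalar[OF T hy this]
  obtain E where E: "E \<in> \<C>" "norm (defect h y E ?T) \<le> r / 2" by blast
  have "defect h y E ?T = (P E o\<^sub>L adj b o\<^sub>L b o\<^sub>L P E) - r *\<^sub>R P E"
    unfolding defect_def coeff by (simp add: W_scaleR indicator_linf E P_def blinfun_compose_assoc)
  then have "P E - (1/r) *\<^sub>R (P E o\<^sub>L adj b o\<^sub>L b o\<^sub>L P E) = - (1/r) *\<^sub>R defect h y E ?T"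
    using r by (simp add: scaleR_diff_right)
  then have "norm (P E - (1/r) *\<^sub>R (P E o\<^sub>L adj b o\<^sub>L b o\<^sub>L P E)) = norm (defect h y E ?T) / r"
    using r by simp
  also have "\<dots> < 1" using E(2) r by (simp add: field_simps)
  finally show ?thesis
    using corner_partial_isometry[OF b(1) P_in_crossed[OF E(1)] projection_P[OF E(1)] r] E(1) that by blast
qed

section \<open>Simplicity and pure infiniteness\<close>

text \<open>
  By transitivity the proper inclusion of basic sets can be moved to \<open>E \<subset> C\<close> for the given \<open>C\<close>, and
  again by transitivity \<open>E = gC\<close>; then \<open>\<lambda>\<^sub>g \<chi>\<^sub>C\<close> maps \<open>C\<close> onto a proper subset of itself.
\<close>

lemma infinite_projection_P:
  assumes "C \<in> \<C>"
  shows "infinite_projection crossed (P C)"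
proof -
  obtain C0 E0 where 0: "C0 \<in> \<C>" "E0 \<in> \<C>" "E0 \<subset> C0" using compressible by blast
  obtain k where k: "k \<in> carrier G" "\<beta> k ` C0 = C" using transitive[OF 0(1) assms] by blast
  have "inj_on (\<beta> k) C0" using inverse_left[OF k(1)] basic_subset[OF 0(1)] by (metis inj_on_def subsetD)
  then have sub: "\<beta> k ` E0 \<subset> C" using 0(3) k(2) by (metis image_strict_mono)
  obtain g where g: "g \<in> carrier G" "\<beta> g ` C = \<beta> k ` E0"
    using transitive[OF assms image[OF k(1) 0(2)]] by blast
  let ?E = "\<beta> g ` C"
  have E: "?E \<in> \<C>" "?E \<subset> C" using image[OF g(1) assms] sub g(2) by auto
  note v = partial_isometry_between[OF assms g(1)]
  have "P C o\<^sub>L P ?E = P ?E" "P ?E \<noteq> P C"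
    using E P_P[OF assms] P_inj[OF E(1) assms] by auto
  then show ?thesis
    unfolding infinite_projection_def
    using v(1-3) P_in_crossed[OF assms] projection_P[OF assms] P_in_crossed[OF E(1)] projection_P[OF E(1)]
    by blast
qed

text \<open>
  The partial isometry \<open>w = bd\<close> has source the infinite projection of a basic set, and its range
  projection \<open>bdd*b*\<close> lies in every hereditary subalgebra that contains \<open>b\<close>.
\<close>

theorem purely_infinite_crossed: "purely_infinite crossed"
  unfolding purely_infinite_def
proof (intro conjI allI impI)
  show "cstar_algebra crossed" by (rule cstar_algebra_crossed)
  fix B assume "hereditary_subalgebra crossed B \<and> B \<noteq> {0}"
  then have B: "hereditary_subalgebra crossed B" and "B \<noteq> {0}" by auto
  moreover have "0 \<in> B" "B \<subseteq> crossed"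
    using B subspace_0 by (auto simp: hereditary_subalgebra_def cstar_algebra_def)
  ultimately obtain b where b: "b \<in> B" "b \<in> crossed" "b \<noteq> 0" by blast
  obtain d C where d: "d \<in> crossed" "C \<in> \<C>" "adj (b o\<^sub>L d) o\<^sub>L (b o\<^sub>L d) = P C"
    using basic_projection_below[OF b(2,3)] by blast
  have "infinite_projection crossed ((b o\<^sub>L d) o\<^sub>L adj (b o\<^sub>L d))"
    using infinite_projection_transfer[OF infinite_projection_P[OF d(2)] compose[OF b(2) d(1)] d(3)] .
  with hereditary_compress[OF B b(1) d(1)]
  show "\<exists>p\<in>B. infinite_projection crossed p" by blast
qed

text \<open>
  A nonzero ideal contains the projection of one basic set, hence by transitivity of all of them.
  The functions whose generators, together with those of the conjugate function, lie in the ideal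
  form a C*-algebra, so they exhaust \<open>D\<close>.
\<close>

theorem simple_crossed: "cstar_simple crossed"
  unfolding cstar_simple_def
proof (intro conjI allI impI)
  show "cstar_algebra crossed" by (rule cstar_algebra_crossed)
  obtain C0 where "C0 \<in> \<C>" using compressible by blast
  then show "crossed \<noteq> {0}" using P_in_crossed P_nonzero by blast
  fix J assume J: "closed_ideal crossed J"
  then have Jsub: "J \<subseteq> crossed" "subspace J" "closed J"
    and Jc: "\<And>c T. T \<in> J \<Longrightarrow> cscale_op c o\<^sub>L T \<in> J"
    and Jl: "\<And>S T. S \<in> crossed \<Longrightarrow> T \<in> J \<Longrightarrow> S o\<^sub>L T \<in> J"
    and Jr: "\<And>S T. S \<in> crossed \<Longrightarrow> T \<in> J \<Longrightarrow> T o\<^sub>L S \<in> J"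
    by (auto simp: closed_ideal_def)
  show "J = {0} \<or> J = crossed"
  proof (rule disjCI)
    assume "J \<noteq> crossed"
    show "J = {0}"
    proof (rule ccontr)
      assume "J \<noteq> {0}"
      then obtain b where b: "b \<in> J" "b \<in> crossed" "b \<noteq> 0" using Jsub subspace_0[OF Jsub(2)] by blast
      obtain d C where d: "d \<in> crossed" "C \<in> \<C>" "adj (b o\<^sub>L d) o\<^sub>L (b o\<^sub>L d) = P C"
        using basic_projection_below[OF b(2,3)] by blast
      have PC: "P C \<in> J"
        unfolding d(3)[symmetric] by (intro Jl Jr adj_in compose b d)
      have PE: "P E \<in> J" if E: "E \<in> \<C>" for E
      proof -
        obtain g where g: "g \<in> carrier G" "\<beta> g ` C = E" using transitive[OF d(2) E] by blast
        note v = partial_isometry_between[OF d(2) g(1)]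
        show ?thesis
          unfolding v(4)[symmetric, unfolded g(2)] using v(1) PC g(2) by (intro Jr Jl adj_in) auto
      qed
      let ?K = "{f \<in> D. \<forall>g\<in>carrier G. W f g \<in> J \<and> W (\<lambda>y. cnj (f y)) g \<in> J}"
      have "D \<subseteq> ?K"
      proof (subst (1) D_def, rule linf_cstar_generated_least)
        note S = D_subalg[unfolded linf_cstar_subalgebra_def]
        show "linf_cstar_subalgebra X ?K"
          unfolding linf_cstar_subalgebra_def
        proof (intro conjI ballI allI impI)
          show "?K \<subseteq> linf X" using D_linf by auto
          show "(\<lambda>_. 0) \<in> ?K" using D_zero by (simp add: W_zero subspace_0[OF Jsub(2)])
          fix f assume f: "f \<in> ?K"
          show "(\<lambda>y. c * f y) \<in> ?K" for c
            using f by (auto intro!: D_cmult Jc simp: W_scaleC D_linf linf_cnj)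
          show "(\<lambda>y. cnj (f y)) \<in> ?K"
            using f by (auto intro!: D_cnj)
          fix f' assume f': "f' \<in> ?K"
          show "(\<lambda>y. f y + f' y) \<in> ?K"
            using f f' S by (auto intro!: subspace_add[OF Jsub(2)] simp: W_add D_linf linf_cnj)
          have "W (\<lambda>y. u y * u' y) g \<in> J" if "u \<in> D" "u' \<in> D" "g \<in> carrier G" "W u' g \<in> J" for u u' g
            using Jl[OF W_in_crossed[OF that(1) one_closed] that(4)] that
            by (simp add: W_mult D_linf act_one)
          then show "(\<lambda>y. f y * f' y) \<in> ?K"
            using f f' D_cnj by (auto intro!: D_mult)
        next
          fix F f assume f: "f \<in> linf X" and F: "(\<forall>n. F n \<in> ?K) \<and> uniform_limit X F f sequentially"
          have FD: "F n \<in> D" "F n \<in> linf X" for n using F D_linf by auto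
          have fD: "f \<in> D" using S f F by blast
          have lim: "W u g \<in> J" if u: "u \<in> linf X" "\<And>n. U n \<in> linf X" "\<And>n. W (U n) g \<in> J"
            and lim: "\<And>n y. y \<in> X \<Longrightarrow> cmod (u y - U n y) = cmod (f y - F n y)" and g: "g \<in> carrier G" for u U g
          proof (rule closed_sequentially[OF Jsub(3)])
            show "W (U n) g \<in> J" for n by fact
            show "(\<lambda>n. W (U n) g) \<longlonglongrightarrow> W u g"
            proof (rule LIMSEQ_I)
              fix e :: real assume e: "0 < e"
              have "\<forall>\<^sub>F n in sequentially. \<forall>y\<in>X. dist (F n y) (f y) < e / 2"
                using F e by (intro uniform_limitD) auto
              then obtain n0 where n0: "\<And>n y. n \<ge> n0 \<Longrightarrow> y \<in> X \<Longrightarrow> dist (F n y) (f y) < e / 2"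
                unfolding eventually_sequentially by blast
              have "norm (W (U n) g - W u g) < e" if "n \<ge> n0" for n
              proof -
                have "norm (W (\<lambda>y. u y - U n y) g) \<le> e / 2"
                  using u g e n0[OF that] lim
                  by (intro norm_W_le linf_diff) (auto simp: dist_norm norm_minus_commute less_imp_le)
                then show ?thesis using u g e by (simp add: W_diff norm_minus_commute)
              qed
              then show "\<exists>n0. \<forall>n\<ge>n0. norm (W (U n) g - W u g) < e" by blast
            qed
          qed
          have "W f g \<in> J" "W (\<lambda>y. cnj (f y)) g \<in> J" if g: "g \<in> carrier G" for g
            using lim[of f F g] lim[of "\<lambda>y. cnj (f y)" "\<lambda>n y. cnj (F n y)" g] f F FD g linf_cnj
            by (auto simp flip: complex_cnj_diff)
          with fD show "f \<in> ?K" by blast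
        qed
        have "W (indicator E) g \<in> J" if "E \<in> \<C>" "g \<in> carrier G" for E g
        proof -
          have "(\<lambda>y. indicator E y * indicator E y :: complex) = indicator E" by (auto simp: indicator_def)
          then have "W (indicator E) g = P E o\<^sub>L W (indicator E) g"
            using that by (simp add: P_W indicator_linf)
          also have "\<dots> \<in> J" using that by (intro Jr PE W_in_crossed indicator_in_D)
          finally show ?thesis .
        qed
        then show "indicator ` \<C> \<subseteq> ?K" using indicator_in_D by (auto simp: cnj_indicator)
      qed
      then have "crossed \<subseteq> J" by (intro crossed_subset Jsub) auto
      with Jsub \<open>J \<noteq> crossed\<close> show False by blast
    qed
  qed
qed

end

section \<open>The action of a semidirect product on cosets\<close>

locale split_extension = group G for G :: "('g, 'r) monoid_scheme" (structure) +
  fixes N H :: "'g set"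
  assumes semidirect: "semidirect G N H"
begin

lemma N_normal: "N \<lhd> G" and H_subgroup: "subgroup H G" and N_int_H: "N \<inter> H = {\<one>}"
  and NH: "N <#> H = carrier G"
  using semidirect by (auto simp: semidirect_def)

lemma N_subgroup: "subgroup N G"
  using N_normal by (rule normal_imp_subgroup)

lemma N_carrier [simp]: "x \<in> N \<Longrightarrow> x \<in> carrier G"
  and H_carrier [simp]: "a \<in> H \<Longrightarrow> a \<in> carrier G"
  using N_subgroup H_subgroup subgroup.mem_carrier by fast+

lemma N_closed [simp]: "x \<in> N \<Longrightarrow> y \<in> N \<Longrightarrow> x \<otimes> y \<in> N" "x \<in> N \<Longrightarrow> inv x \<in> N" "\<one> \<in> N"
  and H_closed [simp]: "a \<in> H \<Longrightarrow> b \<in> H \<Longrightarrow> a \<otimes> b \<in> H" "a \<in> H \<Longrightarrow> inv a \<in> H" "\<one> \<in> H"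
  using N_subgroup H_subgroup
  by (auto intro: subgroup.m_closed subgroup.m_inv_closed subgroup.one_closed)

lemma N_conj [simp]: "x \<in> N \<Longrightarrow> a \<in> carrier G \<Longrightarrow> a \<otimes> x \<otimes> inv a \<in> N"
  by (rule normal.inv_op_closed2[OF N_normal])

lemma N_conj' [simp]: "x \<in> N \<Longrightarrow> a \<in> carrier G \<Longrightarrow> a \<otimes> (x \<otimes> inv a) \<in> N"
  using N_conj[of x a] by (simp add: m_assoc)

lemma cancel_inv:
  "x \<in> carrier G \<Longrightarrow> a \<in> carrier G \<Longrightarrow> inv a \<otimes> (a \<otimes> x) = x"
  "x \<in> carrier G \<Longrightarrow> a \<in> carrier G \<Longrightarrow> a \<otimes> (inv a \<otimes> x) = x"
  by (simp_all flip: m_assoc)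

lemmas group_simps = m_assoc inv_mult_group cancel_inv

lemma factorization:
  assumes "g \<in> carrier G"
  obtains x a where "x \<in> N" "a \<in> H" "g = x \<otimes> a"
  using assms NH unfolding set_mult_def by blast

lemma factorization_unique:
  assumes "x \<in> N" "a \<in> H" "x' \<in> N" "a' \<in> H" "x \<otimes> a = x' \<otimes> a'"
  shows "x = x' \<and> a = a'"
proof -
  have "inv x' \<otimes> x = inv x' \<otimes> (x \<otimes> a) \<otimes> inv a" using assms(1-4) by (simp add: group_simps)
  also have "\<dots> = a' \<otimes> inv a" unfolding assms(5) using assms(1-4) by (simp add: group_simps)
  finally have eq: "inv x' \<otimes> x = a' \<otimes> inv a" .
  then have "inv x' \<otimes> x \<in> N \<inter> H" using assms(1-4) by (metis H_closed(1,2) IntI N_closed(1,2))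
  then have "inv x' \<otimes> x = \<one>" "a' \<otimes> inv a = \<one>" using N_int_H eq by auto
  then show ?thesis
    using assms(1-4) by (metis H_carrier N_carrier inv_closed inv_equality inv_inv)
qed

lemma beta_eq: "x \<in> N \<Longrightarrow> a \<in> H \<Longrightarrow> beta G N H (x \<otimes> a) y = x \<otimes> a \<otimes> y \<otimes> inv a"
  unfolding beta_def by (rule the_equality) (use factorization_unique in blast)+

sublocale discrete_action G N "beta G N H"
proof unfold_locales
  fix g y assume g: "g \<in> carrier G" and y: "y \<in> N"
  obtain x a where xa: "x \<in> N" "a \<in> H" "g = x \<otimes> a" using factorization[OF g] .
  show "beta G N H g y \<in> N" using xa y by (simp add: beta_eq m_assoc)
  fix h assume h: "h \<in> carrier G"
  obtain z b where zb: "z \<in> N" "b \<in> H" "h = z \<otimes> b" using factorization[OF h] .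
  have "g \<otimes> h = (x \<otimes> (a \<otimes> z \<otimes> inv a)) \<otimes> (a \<otimes> b)"
    using xa zb by (simp add: group_simps)
  moreover have "x \<otimes> (a \<otimes> z \<otimes> inv a) \<in> N" "a \<otimes> b \<in> H" using xa zb by simp_all
  ultimately show "beta G N H (g \<otimes> h) y = beta G N H g (beta G N H h y)"
    using xa zb y by (simp add: beta_eq) (simp add: group_simps)
next
  fix y assume "y \<in> N"
  then show "beta G N H \<one> y = y" using beta_eq[of \<one> \<one> y] by simp
qed

lemma act_eq_alpha: "act = alpha G N H"
  by (simp add: act_def alpha_def fun_eq_iff)

end

locale separating_conjugates = split_extension G N H for G :: "('g, 'r) monoid_scheme" (structure)
    and N H +
  fixes M :: "'g set"
  assumes M_normal: "M \<lhd> G\<lparr>carrier := N\<rparr>" and M_nontrivial: "M \<noteq> {\<one>}"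
    and filter_base: "\<And>U V. U \<in> conjugates G H M \<Longrightarrow> V \<in> conjugates G H M \<Longrightarrow>
      \<exists>W\<in>conjugates G H M. W \<subseteq> U \<inter> V"
    and separating: "\<Inter> (conjugates G H M) = {\<one>}"
    and effective: "\<And>a. a \<in> H \<Longrightarrow> a \<noteq> \<one> \<Longrightarrow> \<exists>s\<in>M. a \<otimes> s \<otimes> inv a \<noteq> s"
begin

abbreviation \<U> :: "'g set set" where "\<U> \<equiv> conjugates G H M"

abbreviation conj_set :: "'g \<Rightarrow> 'g set \<Rightarrow> 'g set" where
  "conj_set a U \<equiv> (\<lambda>u. a \<otimes> u \<otimes> inv a) ` U"

lemma M_subgroup: "subgroup M G"
  using normal_imp_subgroup[OF M_normal] incl_subgroup[OF N_subgroup] by blast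

lemma M_N: "M \<subseteq> N"
  using normal_imp_subgroup[OF M_normal] subgroup.subset by fastforce

lemma conjugates_eq: "\<U> = (\<lambda>a. conj_set a M) ` H"
  unfolding conjugates_def l_coset_def r_coset_def by auto

lemma U_N: "U \<in> \<U> \<Longrightarrow> U \<subseteq> N"
  using M_N by (auto simp: conjugates_eq)

lemma U_carrier [simp]: "U \<in> \<U> \<Longrightarrow> u \<in> U \<Longrightarrow> u \<in> carrier G"
  using U_N N_carrier by blast

lemma conj_set_one: "U \<subseteq> carrier G \<Longrightarrow> conj_set \<one> U = U"
  by (force simp: image_def)

lemma M_in_U: "M \<in> \<U>"
  unfolding conjugates_eq using M_N
  by (intro image_eqI[where x = \<one>] conj_set_one[symmetric]) auto

lemma U_closed:
  assumes "U \<in> \<U>"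
  shows "\<one> \<in> U" "u \<in> U \<Longrightarrow> v \<in> U \<Longrightarrow> u \<otimes> v \<in> U" "u \<in> U \<Longrightarrow> inv u \<in> U"
proof -
  obtain a where a: "a \<in> H" "U = conj_set a M" using assms by (auto simp: conjugates_eq)
  have M: "\<one> \<in> M" "\<And>u v. u \<in> M \<Longrightarrow> v \<in> M \<Longrightarrow> u \<otimes> v \<in> M" "\<And>u. u \<in> M \<Longrightarrow> inv u \<in> M"
    "\<And>u. u \<in> M \<Longrightarrow> u \<in> carrier G"
    using M_subgroup by (auto intro: subgroup.m_closed subgroup.m_inv_closed subgroup.one_closed subgroup.mem_carrier)
  show "\<one> \<in> U" unfolding a(2) using a(1) M by (intro image_eqI[of _ _ \<one>]) auto
  show "u \<in> U \<Longrightarrow> v \<in> U \<Longrightarrow> u \<otimes> v \<in> U"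
    unfolding a(2)
  proof (clarify)
    fix m m' assume m: "m \<in> M" "m' \<in> M"
    have "a \<otimes> m \<otimes> inv a \<otimes> (a \<otimes> m' \<otimes> inv a) = a \<otimes> (m \<otimes> m') \<otimes> inv a"
      using a(1) m M by (simp add: group_simps)
    then show "a \<otimes> m \<otimes> inv a \<otimes> (a \<otimes> m' \<otimes> inv a) \<in> conj_set a M"
      using m M by (intro image_eqI[of _ _ "m \<otimes> m'"]) auto
  qed
  show "u \<in> U \<Longrightarrow> inv u \<in> U"
    unfolding a(2)
  proof (clarify)
    fix m assume m: "m \<in> M"
    have "inv (a \<otimes> m \<otimes> inv a) = a \<otimes> inv m \<otimes> inv a"
      using a(1) m M by (simp add: group_simps)
    then show "inv (a \<otimes> m \<otimes> inv a) \<in> conj_set a M"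
      using m M by (intro image_eqI[of _ _ "inv m"]) auto
  qed
qed

lemma conj_set_compose:
  assumes "a \<in> carrier G" "b \<in> carrier G" "U \<subseteq> carrier G"
  shows "conj_set a (conj_set b U) = conj_set (a \<otimes> b) U"
  unfolding image_image using assms by (intro image_cong) (auto simp: group_simps subset_iff)

lemma conj_set_in_U:
  assumes "a \<in> H" "U \<in> \<U>"
  shows "conj_set a U \<in> \<U>"
proof -
  obtain b where b: "b \<in> H" "U = conj_set b M" using assms by (auto simp: conjugates_eq)
  have "conj_set a U = conj_set (a \<otimes> b) M"
    unfolding b(2) using assms b M_N by (intro conj_set_compose) auto
  then show ?thesis
    unfolding conjugates_eq by (rule image_eqI) (simp add: assms(1) b(1))
qed

lemma conj_set_transitive:
  assumes "U \<in> \<U>" "V \<in> \<U>"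
  obtains a where "a \<in> H" "conj_set a U = V"
proof -
  obtain b c where b: "b \<in> H" "U = conj_set b M" and c: "c \<in> H" "V = conj_set c M"
    using assms by (auto simp: conjugates_eq)
  have "conj_set (c \<otimes> inv b) U = conj_set (c \<otimes> inv b \<otimes> b) M"
    unfolding b(2) using b c M_N by (intro conj_set_compose) auto
  also have "\<dots> = V" using b c by (simp add: m_assoc)
  finally show ?thesis using that[of "c \<otimes> inv b"] b c by simp
qed

lemma mem_coset:
  assumes "x \<in> N" "U \<in> \<U>"
  shows "y \<in> x <# U \<longleftrightarrow> y \<in> N \<and> inv x \<otimes> y \<in> U"
proof
  assume "y \<in> x <# U"
  then obtain u where u: "u \<in> U" "y = x \<otimes> u" by (auto simp: l_coset_def)
  then have "u \<in> N" using U_N assms by blast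
  with u assms show "y \<in> N \<and> inv x \<otimes> y \<in> U" by (simp add: cancel_inv)
next
  assume y: "y \<in> N \<and> inv x \<otimes> y \<in> U"
  then have "y = x \<otimes> (inv x \<otimes> y)" using assms by (simp add: cancel_inv)
  with y show "y \<in> x <# U" unfolding l_coset_def by blast
qed

lemma coset_eq:
  assumes "x \<in> N" "U \<in> \<U>" "y \<in> x <# U"
  shows "y <# U = x <# U"
proof -
  have y: "y \<in> N" "inv x \<otimes> y \<in> U" using assms by (auto simp: mem_coset)
  have yx: "inv y \<otimes> x \<in> U"
    using U_closed(3)[OF assms(2) y(2)] y assms by (simp add: group_simps)
  have "inv y \<otimes> z \<in> U \<longleftrightarrow> inv x \<otimes> z \<in> U" if z: "z \<in> N" for z
  proof
    assume "inv y \<otimes> z \<in> U"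
    from U_closed(2)[OF assms(2) y(2) this] show "inv x \<otimes> z \<in> U"
      using y z assms by (simp add: group_simps)
  next
    assume "inv x \<otimes> z \<in> U"
    from U_closed(2)[OF assms(2) yx this] show "inv y \<otimes> z \<in> U"
      using y z assms by (simp add: group_simps)
  qed
  then show ?thesis using y(1) assms by (auto simp: mem_coset)
qed

lemma self_mem_coset: "x \<in> N \<Longrightarrow> U \<in> \<U> \<Longrightarrow> x \<in> x <# U"
  by (simp add: mem_coset U_closed)

lemma coset_mono: "V \<subseteq> U \<Longrightarrow> x <# V \<subseteq> x <# U"
  by (auto simp: l_coset_def)

text \<open>The group permutes the cosets: \<open>za\<close> maps \<open>xU\<close> to \<open>zaxa\<^sup>-\<^sup>1 \<cdot> aUa\<^sup>-\<^sup>1\<close>.\<close>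

lemma beta_image_coset:
  assumes "z \<in> N" "a \<in> H" "x \<in> N" "U \<in> \<U>"
  shows "beta G N H (z \<otimes> a) ` (x <# U) = beta G N H (z \<otimes> a) x <# conj_set a U"
proof -
  have coset_image: "y <# V = (\<lambda>v. y \<otimes> v) ` V" for y V
    by (auto simp: l_coset_def)
  have "beta G N H (z \<otimes> a) (x \<otimes> u) = beta G N H (z \<otimes> a) x \<otimes> (a \<otimes> u \<otimes> inv a)" if "u \<in> U" for u
    using assms that by (simp add: beta_eq group_simps)
  then show ?thesis unfolding coset_image image_image by (rule image_cong[OF refl])
qed

text \<open>
  If \<open>za\<close> fixes a coset \<open>xU\<close> pointwise, then \<open>a\<close> centralizes \<open>U\<close>; a conjugate of \<open>a\<close> then
  centralizes \<open>M\<close>, so \<open>a = 1\<close> by effectiveness, and the translation by \<open>z\<close> has a fixed point.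
\<close>

lemma moves_point_in_coset:
  assumes g: "g \<in> carrier G" "g \<noteq> \<one>" and x: "x \<in> N" and U: "U \<in> \<U>"
  shows "\<exists>y\<in>x <# U. beta G N H g y \<noteq> y"
proof (rule ccontr)
  assume "\<not> ?thesis"
  then have fixed: "beta G N H g (x \<otimes> u) = x \<otimes> u" if "u \<in> U" for u
    using that by (auto simp: l_coset_def)
  obtain z a where za: "z \<in> N" "a \<in> H" "g = z \<otimes> a" using factorization[OF g(1)] .
  have fix_x: "z \<otimes> a \<otimes> x \<otimes> inv a = x"
    using fixed[OF U_closed(1)[OF U]] x za by (simp add: beta_eq)
  have cent: "a \<otimes> u \<otimes> inv a = u" if u: "u \<in> U" for u
  proof -
    have uG: "u \<in> carrier G" using u U by simp
    have "x \<otimes> (a \<otimes> u \<otimes> inv a) = (z \<otimes> a \<otimes> x \<otimes> inv a) \<otimes> (a \<otimes> u \<otimes> inv a)" by (simp add: fix_x)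
    also have "\<dots> = beta G N H g (x \<otimes> u)" using za x uG by (simp add: beta_eq group_simps)
    also have "\<dots> = x \<otimes> u" by (rule fixed[OF u])
    finally show ?thesis using za x uG by simp
  qed
  obtain b where b: "b \<in> H" "U = conj_set b M" using U by (auto simp: conjugates_eq)
  let ?c = "inv b \<otimes> a \<otimes> b"
  have "?c \<otimes> s \<otimes> inv ?c = s" if s: "s \<in> M" for s
  proof -
    have sG: "s \<in> carrier G" using s M_N by auto
    have "?c \<otimes> s \<otimes> inv ?c = inv b \<otimes> (a \<otimes> (b \<otimes> s \<otimes> inv b) \<otimes> inv a) \<otimes> b"
      using sG za b by (simp add: group_simps)
    also have "a \<otimes> (b \<otimes> s \<otimes> inv b) \<otimes> inv a = b \<otimes> s \<otimes> inv b"
      using s b(2) by (intro cent) auto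
    also have "inv b \<otimes> \<dots> \<otimes> b = s" using sG b by (simp add: group_simps)
    finally show ?thesis .
  qed
  then have c: "?c = \<one>" using effective[of ?c] za b by auto
  have "a = b \<otimes> ?c \<otimes> inv b" using za b by (simp add: group_simps)
  then have a: "a = \<one>" unfolding c using b by simp
  then have "z \<otimes> x = x" using fix_x za x by simp
  then have "z = \<one>" using za x by simp
  with a za g show False by simp
qed

lemma separated_from:
  assumes "w \<noteq> \<one>"
  obtains V where "V \<in> \<U>" "w \<notin> V"
  using assms separating by blast

lemma displaced_coset:
  assumes g: "g \<in> carrier G" "g \<noteq> \<one>" and x: "x \<in> N" and U: "U \<in> \<U>"
  shows "\<exists>y\<in>N. \<exists>W\<in>\<U>. y <# W \<subseteq> x <# U \<and> (y <# W) \<inter> beta G N H g ` (y <# W) = {}"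
proof -
  obtain y where y: "y \<in> x <# U" "beta G N H g y \<noteq> y" using moves_point_in_coset[OF assms] by blast
  obtain z a where za: "z \<in> N" "a \<in> H" "g = z \<otimes> a" using factorization[OF g(1)] .
  define w where "w = beta G N H g y"
  have yN: "y \<in> N" using y x U by (simp add: mem_coset)
  have wN: "w \<in> N" unfolding w_def using g yN by (intro maps)
  have "w = y \<otimes> (inv y \<otimes> w)" using yN wN by (simp add: cancel_inv)
  then have "inv y \<otimes> w \<noteq> \<one>" using y(2) yN by (auto simp: w_def)
  then obtain V where V: "V \<in> \<U>" "inv y \<otimes> w \<notin> V" by (rule separated_from)
  have "conj_set (inv a) V \<in> \<U>" using V za by (intro conj_set_in_U) auto
  then obtain V' where V': "V' \<in> \<U>" "V' \<subseteq> V \<inter> conj_set (inv a) V"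
    using filter_base[OF V(1)] by blast
  obtain W where "W \<in> \<U>" "W \<subseteq> U \<inter> V'" using filter_base[OF U V'(1)] by blast
  with V'(2) have W: "W \<in> \<U>" "W \<subseteq> U" "W \<subseteq> V" "W \<subseteq> conj_set (inv a) V" by auto
  have aW: "conj_set a W \<subseteq> V"
  proof -
    have "conj_set a W \<subseteq> conj_set a (conj_set (inv a) V)" using W(4) by (rule image_mono)
    also have "\<dots> = conj_set (a \<otimes> inv a) V"
      using za V U_N N_carrier by (intro conj_set_compose) auto
    also have "\<dots> = V" using za V(1) by (simp add: conj_set_one subset_iff)
    finally show ?thesis .
  qed
  have img: "beta G N H g ` (y <# W) = w <# conj_set a W"
    unfolding w_def za(3) using za yN W by (intro beta_image_coset)
  have "p \<notin> w <# conj_set a W" if p: "p \<in> y <# W" for p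
  proof
    assume p': "p \<in> w <# conj_set a W"
    have pN: "p \<in> N" "inv y \<otimes> p \<in> V" using p W yN by (auto simp: mem_coset)
    have "inv w \<otimes> p \<in> V"
      using p' aW wN conj_set_in_U[OF za(2) W(1)] by (auto simp: mem_coset)
    then have "(inv y \<otimes> p) \<otimes> inv (inv w \<otimes> p) \<in> V" using U_closed(2,3)[OF V(1)] pN by blast
    then show False using V(2) pN yN wN by (simp add: group_simps)
  qed
  then have "(y <# W) \<inter> beta G N H g ` (y <# W) = {}" unfolding img by (simp add: disjoint_iff)
  moreover have "y <# W \<subseteq> x <# U" using coset_mono[OF W(2)] coset_eq[OF x U y(1)] by metis
  ultimately show ?thesis using yN W(1)
    by - (rule bexI[of _ y], rule bexI[of _ W], rule conjI; assumption)
qed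

abbreviation cosets :: "'g set set" where
  "cosets \<equiv> {x <# U | x U. x \<in> N \<and> U \<in> \<U>}"

lemma coset_in_cosets: "x \<in> N \<Longrightarrow> U \<in> \<U> \<Longrightarrow> x <# U \<in> cosets"
  by blast

sublocale clopen_family G N "beta G N H" cosets
proof unfold_locales
  show "C \<subseteq> N" if "C \<in> cosets" for C using that by (auto simp: mem_coset)
  show "C \<noteq> {}" if "C \<in> cosets" for C using that self_mem_coset by blast
  show "beta G N H g ` C \<in> cosets" if g: "g \<in> carrier G" and C: "C \<in> cosets" for g C
  proof -
    obtain z a where za: "z \<in> N" "a \<in> H" "g = z \<otimes> a" using factorization[OF g] .
    obtain x U where x: "x \<in> N" "U \<in> \<U>" "C = x <# U" using C by blast
    have "beta G N H g ` C = beta G N H g x <# conj_set a U"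
      unfolding za(3) x(3) by (intro beta_image_coset za x)
    then show ?thesis using maps[OF g x(1)] conj_set_in_U[OF za(2) x(2)] by blast
  qed
  show "\<exists>g\<in>carrier G. beta G N H g ` C = C'" if C: "C \<in> cosets" "C' \<in> cosets" for C C'
  proof -
    obtain x U x' U' where x: "x \<in> N" "U \<in> \<U>" "C = x <# U" and x': "x' \<in> N" "U' \<in> \<U>" "C' = x' <# U'"
      using C by blast
    obtain a where a: "a \<in> H" "conj_set a U = U'" by (rule conj_set_transitive[OF x(2) x'(2)])
    \<comment> \<open>The \<open>N\<close>-part is chosen so that \<open>za\<close> maps \<open>x\<close> to \<open>x'\<close>.\<close>
    let ?z = "x' \<otimes> inv (a \<otimes> x \<otimes> inv a)"
    have z: "?z \<in> N" using x x' a by simp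
    have "beta G N H (?z \<otimes> a) x = x'"
      unfolding beta_eq[OF z a(1)] using x x' a by (simp add: group_simps)
    then have "beta G N H (?z \<otimes> a) ` C = C'"
      unfolding x(3) x'(3) by (simp add: beta_image_coset z a x)
    then show ?thesis using z a by (intro bexI[of _ "?z \<otimes> a"]) auto
  qed
  show "\<exists>E\<in>cosets. x \<in> E \<and> E \<subseteq> C \<inter> C'" if C: "C \<in> cosets" "C' \<in> cosets" "x \<in> C \<inter> C'" for C C' x
  proof -
    obtain z U z' U' where z: "z \<in> N" "U \<in> \<U>" "C = z <# U" and z': "z' \<in> N" "U' \<in> \<U>" "C' = z' <# U'"
      using C by blast
    obtain W where W: "W \<in> \<U>" "W \<subseteq> U \<inter> U'" using filter_base[OF z(2) z'(2)] by blast
    have x: "x \<in> z <# U" "x \<in> z' <# U'" using C(3) z(3) z'(3) by auto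
    then have xN: "x \<in> N" using mem_coset[OF z(1,2)] by blast
    have "x <# U = C" "x <# U' = C'"
      using coset_eq[OF z(1,2) x(1)] coset_eq[OF z'(1,2) x(2)] z(3) z'(3) by auto
    then have "x <# W \<subseteq> C \<inter> C'" using coset_mono[of W U x] coset_mono[of W U' x] W(2) by auto
    then show ?thesis
      using self_mem_coset[OF xN W(1)] by (intro bexI[OF _ coset_in_cosets[OF xN W(1)]] conjI)
  qed
  show "\<exists>C\<in>cosets. x \<in> C" if "x \<in> N" for x
    using self_mem_coset[OF that M_in_U] by (rule bexI[OF _ coset_in_cosets[OF that M_in_U]])
  show "\<exists>E\<in>cosets. x \<in> E \<and> E \<inter> C = {}" if C: "C \<in> cosets" and x: "x \<in> N - C" for C x
  proof -
    obtain z U where z: "z \<in> N" "U \<in> \<U>" "C = z <# U" using C by blast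
    have xN: "x \<in> N" using x by simp
    have "(x <# U) \<inter> C = {}"
    proof (rule ccontr)
      assume "(x <# U) \<inter> C \<noteq> {}"
      then obtain p where p: "p \<in> x <# U" "p \<in> z <# U" using z(3) by blast
      have "x <# U = C" using coset_eq[OF xN z(2) p(1)] coset_eq[OF z(1,2) p(2)] z(3) by simp
      then show False using self_mem_coset[OF xN z(2)] x by simp
    qed
    then show ?thesis
      using self_mem_coset[OF xN z(2)] by (intro bexI[OF _ coset_in_cosets[OF xN z(2)]] conjI)
  qed
  show "\<exists>E\<in>cosets. E \<subseteq> C \<and> E \<inter> beta G N H g ` E = {}"
    if g: "g \<in> carrier G" "g \<noteq> \<one>" and C: "C \<in> cosets" for g C
  proof -
    obtain x U where x: "x \<in> N" "U \<in> \<U>" "C = x <# U" using C by blast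
    obtain y W where y: "y \<in> N" "W \<in> \<U>" "y <# W \<subseteq> C" "(y <# W) \<inter> beta G N H g ` (y <# W) = {}"
      using displaced_coset[OF g x(1,2)] x(3) by metis
    show ?thesis by (intro bexI[OF _ coset_in_cosets[OF y(1,2)]] conjI y(3,4))
  qed
  show "\<exists>C\<in>cosets. \<exists>E\<in>cosets. E \<subset> C"
  proof -
    obtain m where m: "m \<in> M" "m \<noteq> \<one>" using M_nontrivial U_closed(1)[OF M_in_U] by blast
    obtain V where V: "V \<in> \<U>" "m \<notin> V" using separated_from[OF m(2)] .
    obtain W where W: "W \<in> \<U>" "W \<subseteq> M \<inter> V" using filter_base[OF M_in_U V(1)] by blast
    have "m \<in> \<one> <# M" "m \<notin> \<one> <# W" "\<one> <# W \<subseteq> \<one> <# M"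
      using m V W M_in_U M_N coset_mono[of W M] by (auto simp: mem_coset)
    then have "\<one> <# W \<subset> \<one> <# M" by (metis psubsetI)
    then show ?thesis
      by (intro bexI[of _ "\<one> <# M"] bexI[of _ "\<one> <# W"] coset_in_cosets M_in_U W(1) N_closed(3))
  qed
qed

lemma D_eq_coset_algebra: "D = coset_algebra G N \<U>"
proof -
  have "indicator ` cosets = coset_functions G N \<U>"
    unfolding coset_functions_def by auto
  then show ?thesis by (simp add: D_def coset_algebra_def)
qed

end

theorem theorem3p1:
  fixes G :: "('g, 'r) monoid_scheme" (structure)
    and N H M :: "'g set"
  defines "\<U> \<equiv> conjugates G H M"
  assumes "group G"
    and "semidirect G N H"
    and "M \<lhd> G\<lparr>carrier := N\<rparr>" and "M \<noteq> {\<one>}"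
    and filter_base: "\<forall>U\<in>\<U>. \<forall>V\<in>\<U>. \<exists>W\<in>\<U>. W \<subseteq> U \<inter> V"
    and separating: "\<Inter>\<U> = {\<one>}"
    and finite_quotients:
      "\<forall>U\<in>\<U>. \<forall>V\<in>\<U>. V \<subseteq> U \<longrightarrow> finite (carrier (G\<lparr>carrier := U\<rparr> Mod V))"
    and effective: "\<forall>a\<in>H. a \<noteq> \<one> \<longrightarrow> (\<exists>s\<in>M. a \<otimes> s \<otimes> inv a \<noteq> s)"
  shows "cstar_simple (reduced_crossed_product G N (coset_algebra G N \<U>) (alpha G N H)) \<and>
    purely_infinite (reduced_crossed_product G N (coset_algebra G N \<U>) (alpha G N H))"
proof -
  interpret separating_conjugates G N H M
  proof (intro separating_conjugates.intro split_extension.intro split_extension_axioms.intro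
      separating_conjugates_axioms.intro)
    show "\<exists>W\<in>conjugates G H M. W \<subseteq> U \<inter> V"
      if "U \<in> conjugates G H M" "V \<in> conjugates G H M" for U V
      using that by (rule filter_base[unfolded \<U>_def, rule_format])
    show "\<Inter> (conjugates G H M) = {\<one>}" using separating unfolding \<U>_def .
    show "\<exists>s\<in>M. a \<otimes> s \<otimes> inv a \<noteq> s" if "a \<in> H" "a \<noteq> \<one>" for a
      using that by (rule effective[rule_format])
  qed fact+
  show ?thesis
    using simple_crossed purely_infinite_crossed
    unfolding D_eq_coset_algebra act_eq_alpha \<U>_def by (rule conjI)
qed

end
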